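(* There is a unique, up to scalar multiple, function $g\equiv g(\Lambda)$ (an element of a completion of the quantum torus $\mathbb T_\Lambda$) such that the elements $$\bar D_{a;k}=q^{-ak/2}\,g^k\,\bar D_{a;0}\,g^{-k},\qquad a\in[1,N],\ k\in\mathbb Z,$$ form a solution of the opposite quantum Q-system of type $A_{N-1}^{(1)}$ for all $a,k$, with initial data $\bar D_{a;0}=\Lambda_1\cdots\Lambda_a$ and $\bar D_{a;1}=\Lambda_1\cdots\Lambda_a\,T_1\cdots T_a$.
   Context: $q\in\mathbb C^*$, $|q|<1$. The quantum torus $\mathbb T_\Lambda$ is generated by invertible $\Lambda_i,T_i$ ($i\in[1,N]=\{1,\dots,N\}$) with $\Lambda$'s commuting, $T$'s commuting, and $T_i\Lambda_j=q^{\delta_{ij}}\Lambda_jT_i$. The completion allows infinite series in the variables $\Lambda_{i+1}/\Lambda_i$ ($1\le i\le N-1$) and Gaussian functions such as $e^{(\log T_a)^2/(2\log q)}$, which commutes with all $T_b$, with $\Lambda_b$ for $b\neq a$, and satisfies $e^{(\log T_a)^2/(2\log q)}\Lambda_a e^{-(\log T_a)^2/(2\log q)}=q^{1/2}\Lambda_aT_a$. The opposite quantum Q-system of type $A_{N-1}^{(1)}$ for elements $\bar D_{a;k}$ ($a\in[1,N]$, $k\in\mathbb Z$) consists of the relations $$\bar D_{b;k+i}\,\bar D_{a;k}=q^{i\min(a,b)}\,\bar D_{a;k}\,\bar D_{b;k+i}\qquad(k\in\mathbb Z,\ a,b\in[1,N],\ |i|\le1),$$ $$q^a\,\bar D_{a;k-1}\,\bar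 D_{a;k+1}=\bar D_{a;k}^2-\bar D_{a+1;k}\,\bar D_{a-1;k}\qquad(a\in[1,N],\ k\in\mathbb Z),$$ with $\bar D_{0;k}=1$ and $\bar D_{N+1;k}=0$. *)

theory Defs
  imports Complex_Main "HOL-Algebra.Module"
begin

(* Throughout, s is a square root of q; every occurrence of q^(1/2) is read as s. *)

type_synonym zvec = "nat \<Rightarrow> int"

(* (m, n, l) stands for the normally ordered monomial  Lambda^m T^n G^l,  where
   Lambda^m = prod_i Lambda_i^(m_i),  T^n = prod_i T_i^(n_i),  G^l = prod_i G_i^(l_i)
   and G_i is the Gaussian exp((log T_i)^2 / (2 log q)). *)
type_synonym gmono = "zvec \<times> zvec \<times> zvec"

definition zvecs :: "nat \<Rightarrow> zvec set" where
  "zvecs N = {m. \<forall>i. i \<notin> {1..N} \<longrightarrow> m i = 0}"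

definition eps :: "nat \<Rightarrow> zvec" where
  "eps i = (\<lambda>j. if j = i then 1 else 0)"

(* Exponents of the monomials in the variables Lambda_{i+1} / Lambda_i, 1 <= i <= N - 1. *)
definition ratio_cone :: "nat \<Rightarrow> zvec set" where
  "ratio_cone N =
     {(\<lambda>j. \<Sum>i\<in>{1..<N}. int (k i) * (eps (i + 1) j - eps i j)) | k :: nat \<Rightarrow> nat. True}"

(* From  T_i Lambda_j = q^(delta_ij) Lambda_j T_i  and  G_a Lambda_a G_a^(-1) = q^(1/2) Lambda_a T_a:
     (Lambda^m T^n G^l) (Lambda^m' T^n' G^l')
       = q^(sum_i (n_i m'_i + l_i m'_i^2 / 2)) Lambda^(m + m') T^(n + n' + l m') G^(l + l'),
   where l m' is the componentwise product. *)
fun mono_comp :: "gmono \<Rightarrow> gmono \<Rightarrow> gmono" where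
  "mono_comp (m, n, l) (m', n', l') =
     (\<lambda>i. m i + m' i, \<lambda>i. n i + n' i + l i * m' i, \<lambda>i. l i + l' i)"

(* The exponent of s = q^(1/2) in the formula above. *)
fun mono_twist :: "nat \<Rightarrow> gmono \<Rightarrow> gmono \<Rightarrow> int" where
  "mono_twist N (m, n, l) (m', n', l') = (\<Sum>i\<in>{1..N}. 2 * n i * m' i + l i * (m' i)\<^sup>2)"

(* The completed quantum torus with Gaussians adjoined.  An element is a formal series
   sum_p x(p) p over normally ordered monomials p whose Lambda-exponents lie in finitely many
   translates of ratio_cone, and which has, for each Lambda-exponent, a coefficient that is a
   finite combination of monomials T^n G^l.  (Infinite series in the T_i are not admitted:
   theta functions of T_a times G_a commute with Lambda_a.)  The support condition makes the sum
   defining the product finite. *)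
definition qtorus :: "nat \<Rightarrow> complex \<Rightarrow> (complex, gmono \<Rightarrow> complex) module" where
  "qtorus N s = \<lparr>
     carrier = {x.
        (\<forall>m n l. x (m, n, l) \<noteq> 0 \<longrightarrow> m \<in> zvecs N \<and> n \<in> zvecs N \<and> l \<in> zvecs N)
      \<and> (\<forall>m. finite {(n, l). x (m, n, l) \<noteq> 0})
      \<and> (\<exists>F. finite F \<and> (\<forall>m n l. x (m, n, l) \<noteq> 0 \<longrightarrow>
             (\<exists>m0\<in>F. (\<lambda>i. m i - m0 i) \<in> ratio_cone N)))},
     monoid.mult = (\<lambda>x y p.
        \<Sum>(p1, p2)\<in>{(p1, p2). x p1 \<noteq> 0 \<and> y p2 \<noteq> 0 \<and> mono_comp p1 p2 = p}.
          s powi mono_twist N p1 p2 * x p1 * y p2),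
     one = (\<lambda>p. if p = (\<lambda>i. 0, \<lambda>i. 0, \<lambda>i. 0) then 1 else 0),
     zero = (\<lambda>p. 0),
     add = (\<lambda>x y p. x p + y p),
     smult = (\<lambda>c x p. c * x p) \<rparr>"

definition qmono :: "gmono \<Rightarrow> gmono \<Rightarrow> complex" where
  "qmono p = (\<lambda>p'. if p' = p then 1 else 0)"

definition Lam :: "nat \<Rightarrow> gmono \<Rightarrow> complex" where
  "Lam i = qmono (eps i, \<lambda>j. 0, \<lambda>j. 0)"

definition Tgen :: "nat \<Rightarrow> gmono \<Rightarrow> complex" where
  "Tgen i = qmono (\<lambda>j. 0, eps i, \<lambda>j. 0)"

definition Gauss :: "nat \<Rightarrow> gmono \<Rightarrow> complex" where
  "Gauss i = qmono (\<lambda>j. 0, \<lambda>j. 0, eps i)"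

(* f 1 * f 2 * ... * f a, in this order *)
definition ordered_prod :: "('a, 'b) monoid_scheme \<Rightarrow> (nat \<Rightarrow> 'a) \<Rightarrow> nat \<Rightarrow> 'a" where
  "ordered_prod R f a = foldr (\<lambda>i x. f i \<otimes>\<^bsub>R\<^esub> x) [1..<a + 1] \<one>\<^bsub>R\<^esub>"

definition opposite_quantum_Q_system ::
  "(complex, 'a, 'm) module_scheme \<Rightarrow> nat \<Rightarrow> complex \<Rightarrow> (nat \<Rightarrow> int \<Rightarrow> 'a) \<Rightarrow> bool" where
  "opposite_quantum_Q_system R N q D \<longleftrightarrow>
     (\<forall>a\<in>{1..N}. \<forall>k. D a k \<in> carrier R)
   \<and> (\<forall>k. D 0 k = \<one>\<^bsub>R\<^esub>) \<and> (\<forall>k. D (N + 1) k = \<zero>\<^bsub>R\<^esub>)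
   \<and> (\<forall>k. \<forall>a\<in>{1..N}. \<forall>b\<in>{1..N}. \<forall>i. \<bar>i\<bar> \<le> 1 \<longrightarrow>
        D b (k + i) \<otimes>\<^bsub>R\<^esub> D a k
          = (q powi (i * int (min a b))) \<odot>\<^bsub>R\<^esub> (D a k \<otimes>\<^bsub>R\<^esub> D b (k + i)))
   \<and> (\<forall>a\<in>{1..N}. \<forall>k.
        (q ^ a) \<odot>\<^bsub>R\<^esub> (D a (k - 1) \<otimes>\<^bsub>R\<^esub> D a (k + 1))
          = D a k [^]\<^bsub>R\<^esub> (2::nat) \<ominus>\<^bsub>R\<^esub> D (a + 1) k \<otimes>\<^bsub>R\<^esub> D (a - 1) k)"

(* g is invertible in the completion and its conjugation action generates a solution with the
   prescribed initial data; s powi (- a k) is q^(-ak/2). *)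
definition generates_Q_solution :: "nat \<Rightarrow> complex \<Rightarrow> complex \<Rightarrow> (gmono \<Rightarrow> complex) \<Rightarrow> bool" where
  "generates_Q_solution N q s g \<longleftrightarrow>
     g \<in> Units (qtorus N s)
   \<and> (\<exists>D. opposite_quantum_Q_system (qtorus N s) N q D
        \<and> (\<forall>a\<in>{1..N}. \<forall>k::int.
             D a k = (s powi (- (int a * k))) \<odot>\<^bsub>qtorus N s\<^esub>
               (g [^]\<^bsub>qtorus N s\<^esub> k \<otimes>\<^bsub>qtorus N s\<^esub> D a 0 \<otimes>\<^bsub>qtorus N s\<^esub> g [^]\<^bsub>qtorus N s\<^esub> (- k)))
        \<and> (\<forall>a\<in>{1..N}. D a 0 = ordered_prod (qtorus N s) Lam a)
        \<and> (\<forall>a\<in>{1..N}. D a 1 =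
             ordered_prod (qtorus N s) Lam a \<otimes>\<^bsub>qtorus N s\<^esub> ordered_prod (qtorus N s) Tgen a))"

lemma qmono_carrier:
  assumes "m \<in> zvecs N" "n \<in> zvecs N" "l \<in> zvecs N"
  shows "qmono (m, n, l) \<in> carrier (qtorus N s)"
proof -
  have "(\<lambda>i. 0) \<in> ratio_cone N"
    unfolding ratio_cone_def by (rule CollectI, rule exI[of _ "\<lambda>_. 0"]) simp
  moreover have "finite {(n', l'). qmono (m, n, l) (m', n', l') \<noteq> 0}" for m'
    by (rule finite_subset[of _ "{(n, l)}"]) (auto simp: qmono_def split: if_splits)
  moreover have "\<exists>F. finite F \<and> (\<forall>m' n' l'. qmono (m, n, l) (m', n', l') \<noteq> 0 \<longrightarrow>
      (\<exists>m0\<in>F. (\<lambda>i. m' i - m0 i) \<in> ratio_cone N))"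
    by (rule exI[of _ "{m}"]) (use calculation(1) in \<open>auto simp: qmono_def split: if_splits\<close>)
  ultimately show ?thesis
    using assms by (auto simp: qtorus_def qmono_def split: if_splits)
qed

lemma qmono_mult:
  "qmono p1 \<otimes>\<^bsub>qtorus N s\<^esub> qmono p2
     = (s powi mono_twist N p1 p2) \<odot>\<^bsub>qtorus N s\<^esub> qmono (mono_comp p1 p2)"
proof
  fix p
  have *: "{(p1', p2'). qmono p1 p1' \<noteq> 0 \<and> qmono p2 p2' \<noteq> 0 \<and> mono_comp p1' p2' = p}
      = (if mono_comp p1 p2 = p then {(p1, p2)} else {})"
    by (auto simp: qmono_def split: if_splits)
  show "(qmono p1 \<otimes>\<^bsub>qtorus N s\<^esub> qmono p2) p
     = ((s powi mono_twist N p1 p2) \<odot>\<^bsub>qtorus N s\<^esub> qmono (mono_comp p1 p2)) p"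
    by (simp add: qtorus_def *) (simp add: qmono_def)
qed

lemma Lam_commute: "Lam i \<otimes>\<^bsub>qtorus N s\<^esub> Lam j = Lam j \<otimes>\<^bsub>qtorus N s\<^esub> Lam i"
  by (simp add: Lam_def qmono_mult add.commute)

lemma Tgen_commute: "Tgen i \<otimes>\<^bsub>qtorus N s\<^esub> Tgen j = Tgen j \<otimes>\<^bsub>qtorus N s\<^esub> Tgen i"
  by (simp add: Tgen_def qmono_mult add.commute)

lemma Tgen_Lam:
  assumes "i \<in> {1..N}"
  shows "Tgen i \<otimes>\<^bsub>qtorus N s\<^esub> Lam j
    = (if i = j then s\<^sup>2 else 1) \<odot>\<^bsub>qtorus N s\<^esub> (Lam j \<otimes>\<^bsub>qtorus N s\<^esub> Tgen i)"
proof -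
  have "(\<Sum>k = Suc 0..N. 2 * eps i k * eps j k) = (if i = j then 2 else 0)"
  proof -
    have "2 * eps i k * eps j k = (if k = i then (if i = j then 2 else 0) else 0)" for k
      by (auto simp: eps_def)
    then show ?thesis using assms by simp
  qed
  then show ?thesis
    by (simp add: Tgen_def Lam_def qmono_mult) (simp add: qtorus_def)
qed

lemma Gauss_Tgen: "Gauss i \<otimes>\<^bsub>qtorus N s\<^esub> Tgen j = Tgen j \<otimes>\<^bsub>qtorus N s\<^esub> Gauss i"
  by (simp add: Tgen_def Gauss_def qmono_mult)

lemma Gauss_Lam_other:
  assumes "i \<noteq> j"
  shows "Gauss i \<otimes>\<^bsub>qtorus N s\<^esub> Lam j = Lam j \<otimes>\<^bsub>qtorus N s\<^esub> Gauss i"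
proof -
  have [simp]: "eps i k * eps j k = 0" "eps i k * (eps j k)\<^sup>2 = 0" for k
    using assms by (auto simp: eps_def)
  show ?thesis by (simp add: Lam_def Gauss_def qmono_mult)
qed

lemma Gauss_Lam_same:
  assumes "i \<in> {1..N}"
  shows "Gauss i \<otimes>\<^bsub>qtorus N s\<^esub> Lam i
    = s \<odot>\<^bsub>qtorus N s\<^esub> (Lam i \<otimes>\<^bsub>qtorus N s\<^esub> Tgen i \<otimes>\<^bsub>qtorus N s\<^esub> Gauss i)"
proof -
  have *: "(\<Sum>k = Suc 0..N. eps i k * (eps i k)\<^sup>2) = 1"
  proof -
    have "eps i k * (eps i k)\<^sup>2 = (if k = i then 1 else 0)" for k
      by (auto simp: eps_def)
    then show ?thesis using assms by simp
  qed
  have **: "(\<lambda>k. eps i k * eps i k) = eps i"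
    by (auto simp: eps_def)
  have "1 \<odot>\<^bsub>qtorus N s\<^esub> x = x" for x
    by (simp add: qtorus_def)
  with * ** show ?thesis
    by (simp add: Lam_def Gauss_def Tgen_def qmono_mult)
qed

end

theory Submission
  imports Defs
begin

text \<open>
  Write \<open>L\<^sub>a = \<Lambda>\<^sub>1 \<cdots> \<Lambda>\<^sub>a\<close> and \<open>K\<^sub>a = L\<^sub>a T\<^sub>1 \<cdots> T\<^sub>a\<close>. Conjugation by powers of \<open>g\<close> carries the
  relations at \<open>k = 0\<close> to those at all \<open>k\<close>, so a unit \<open>g\<close> generates a solution iff it satisfies the linear
  equations \<open>g L\<^sub>a = s\<^sup>a K\<^sub>a g\<close> and \<open>s\<^bsup>3a\<^esup> L\<^sub>a g K\<^sub>a = g (L\<^sub>a\<^sup>2 - L\<^bsub>a+1\<^esub> L\<^bsub>a-1\<^esub>)\<close>.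
  Since \<open>q\<close> is not a root of unity and the coefficients are finite in the \<open>T\<close> and \<open>G\<close> directions, the first
  family forces \<open>g = G\<^sub>1 \<cdots> G\<^sub>N f(\<Lambda>)\<close>. The second one then says that \<open>f\<close> is homogeneous of degree 0
  and that replacing \<open>\<Lambda>\<^sub>i\<close> by \<open>q\<^sup>-\<^sup>1 \<Lambda>\<^sub>i\<close> for all \<open>i \<le> a\<close> multiplies \<open>f\<close> by \<open>1 - x\<^sub>a\<close>, where
  \<open>x\<^sub>a = \<Lambda>\<^bsub>a+1\<^esub> / \<Lambda>\<^sub>a\<close>. On the completion this recursion has, up to a scalar, the unique solution
  \<open>f = \<Prod>\<^bsub>a<N\<^esub> 1 / (x\<^sub>a; q)\<^sub>\<infinity>\<close>, whose inverse \<open>\<Prod>\<^bsub>a<N\<^esub> (x\<^sub>a; q)\<^sub>\<infinity>\<close> satisfies the dual recursion.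
\<close>

section \<open>Supports and the ratio cone\<close>

text \<open>Partial sums are the coordinates used throughout: up to sign they are the exponents of
  the ratios \<open>Lambda_{a+1} / Lambda_a\<close>, and they are also what
  \<open>T_1 ... T_a\<close> detects when it moves past a monomial in the Lambdas.\<close>

definition psum :: "zvec \<Rightarrow> nat \<Rightarrow> int" where
  "psum m a = (\<Sum>i\<in>{1..a}. m i)"

lemma psum_0 [simp]: "psum m 0 = 0"
  by (simp add: psum_def)

lemma psum_Suc [simp]: "psum m (Suc a) = psum m a + m (Suc a)"
  by (simp add: psum_def)

lemma psum_add [simp]: "psum (\<lambda>i. m i + m' i) a = psum m a + psum m' a"
  and psum_diff [simp]: "psum (\<lambda>i. m i - m' i) a = psum m a - psum m' a"
  by (simp_all add: psum_def sum.distrib sum_subtractf)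

lemma psum_mult: "psum (\<lambda>i. c * m i) a = c * psum m a"
  by (simp add: psum_def sum_distrib_left)

lemma psum_const [simp]: "psum (\<lambda>i. c) a = int a * c"
  by (simp add: psum_def)

lemma zvec_eqI:
  assumes "m \<in> zvecs N" "m' \<in> zvecs N" "\<And>a. a \<in> {1..N} \<Longrightarrow> psum m a = psum m' a"
  shows "m = m'"
proof
  fix i
  show "m i = m' i"
  proof (cases "i \<in> {1..N}")
    case True
    then obtain j where [simp]: "i = Suc j" by (cases i) auto
    have "psum m j = psum m' j" using True assms(3)[of j] by (cases "j = 0") auto
    then show ?thesis using assms(3)[of i] True by simp
  qed (use assms in \<open>auto simp: zvecs_def\<close>)
qed

text \<open>The partial sums of \<open>eps (i + 1) - eps i\<close> vanish except for a -1 at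
  \<open>i\<close>. So the multiplicity of the \<open>a\<close>-th ratio is
  \<open>- psum c a\<close>, and the generators of the cone turn into sign conditions.\<close>

lemma ratio_cone_iff:
  "c \<in> ratio_cone N \<longleftrightarrow> c \<in> zvecs N \<and> (\<forall>a\<in>{1..<N}. psum c a \<le> 0) \<and> psum c N = 0"
proof -
  define \<kappa> :: "(nat \<Rightarrow> nat) \<Rightarrow> zvec" where
    "\<kappa> k = (\<lambda>j. \<Sum>i\<in>{1..<N}. int (k i) * (eps (i + 1) j - eps i j))" for k
  have psum_eps: "psum (eps i) a = (if i \<in> {1..a} then 1 else 0)" for i a
    unfolding psum_def eps_def by (simp add: sum.delta)
  have psum_\<kappa>: "psum (\<kappa> k) a = (if a \<in> {1..<N} then - int (k a) else 0)" for k a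
  proof -
    have "psum (\<kappa> k) a = (\<Sum>i\<in>{1..<N}. int (k i) * (psum (eps (i + 1)) a - psum (eps i) a))"
      unfolding psum_def \<kappa>_def
      by (subst sum.swap) (simp add: sum_distrib_left sum_subtractf right_diff_distrib)
    also have "\<dots> = (\<Sum>i\<in>{1..<N}. if i = a then - int (k a) else 0)"
      by (rule sum.cong) (auto simp: psum_eps)
    finally show ?thesis by (simp add: sum.delta)
  qed
  have zv: "\<kappa> k \<in> zvecs N" for k
    unfolding zvecs_def \<kappa>_def by (auto simp: eps_def intro!: sum.neutral)
  have "c \<in> ratio_cone N \<longleftrightarrow> (\<exists>k. c = \<kappa> k)"
    by (auto simp: ratio_cone_def \<kappa>_def)
  moreover have "c = \<kappa> (\<lambda>a. nat (- psum c a))"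
    if "c \<in> zvecs N" "\<forall>a\<in>{1..<N}. psum c a \<le> 0" "psum c N = 0"
  proof (rule zvec_eqI[OF that(1) zv])
    fix a assume "a \<in> {1..N}"
    then show "psum c a = psum (\<kappa> (\<lambda>a. nat (- psum c a))) a"
      using that by (cases "a = N") (auto simp: psum_\<kappa>)
  qed
  ultimately show ?thesis
    using zv psum_\<kappa> by auto
qed

lemma zvecs_simps [simp]:
  "(\<lambda>i. 0) \<in> zvecs N"
  "m \<in> zvecs N \<Longrightarrow> m' \<in> zvecs N \<Longrightarrow> (\<lambda>i. m i + m' i) \<in> zvecs N"
  "m \<in> zvecs N \<Longrightarrow> m' \<in> zvecs N \<Longrightarrow> (\<lambda>i. m i - m' i) \<in> zvecs N"
  "m \<in> zvecs N \<Longrightarrow> (\<lambda>i. - m i) \<in> zvecs N"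
  "m \<in> zvecs N \<Longrightarrow> (\<lambda>i. l i * m i) \<in> zvecs N"
  by (auto simp: zvecs_def)

lemma zero_in_ratio_cone [simp]: "(\<lambda>i. 0) \<in> ratio_cone N"
  by (simp add: ratio_cone_iff)

lemma ratio_cone_add:
  "c \<in> ratio_cone N \<Longrightarrow> c' \<in> ratio_cone N \<Longrightarrow> (\<lambda>i. c i + c' i) \<in> ratio_cone N"
  by (simp add: ratio_cone_iff add_nonpos_nonpos)

text \<open>In a splitting of \<open>c\<close> inside the cone every partial sum of
  \<open>c1\<close> lies between \<open>psum c a\<close> and 0. Entries are differences of
  consecutive partial sums, so they are bounded too.\<close>

lemma finite_ratio_cone_splits:
  "finite {c1. c1 \<in> ratio_cone N \<and> (\<lambda>i. c i - c1 i) \<in> ratio_cone N}" (is "finite ?S")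
proof -
  define B where "B = (\<Sum>a\<in>{1..<N}. \<bar>psum c a\<bar>)"
  have bnd: "\<bar>psum c1 a\<bar> \<le> B" if "c1 \<in> ?S" "a \<le> N" for c1 a
  proof (cases "a \<in> {1..<N}")
    case True
    then have "\<bar>psum c a\<bar> \<le> B"
      unfolding B_def using member_le_sum[of a "{1..<N}" "\<lambda>a. \<bar>psum c a\<bar>"] by simp
    moreover have "psum c1 a \<le> 0" "psum c a \<le> psum c1 a"
      using that True by (auto simp: ratio_cone_iff)
    ultimately show ?thesis by linarith
  next
    case False
    then have "psum c1 a = 0" using that by (cases "a = 0") (auto simp: ratio_cone_iff not_less)
    moreover have "B \<ge> 0" by (auto simp: B_def intro: sum_nonneg)
    ultimately show ?thesis by simp
  qed
  have "?S \<subseteq> {c1. \<forall>i. (i \<in> {1..N} \<longrightarrow> c1 i \<in> {- 2 * B..2 * B}) \<and> (i \<notin> {1..N} \<longrightarrow> c1 i = 0)}"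
  proof safe
    fix c1 i assume c1: "c1 \<in> ratio_cone N" "(\<lambda>i. c i - c1 i) \<in> ratio_cone N" and i: "i \<in> {1..N}"
    then obtain j where [simp]: "i = Suc j" by (cases i) auto
    have "c1 i = psum c1 i - psum c1 j" by simp
    moreover have "\<bar>psum c1 i\<bar> \<le> B" "\<bar>psum c1 j\<bar> \<le> B"
      using c1 i by (auto intro!: bnd simp del: psum_Suc)
    ultimately show "c1 i \<in> {- 2 * B..2 * B}" by (simp only: atLeastAtMost_iff) linarith
  qed (auto simp: ratio_cone_iff zvecs_def)
  then show ?thesis
    by (rule finite_subset) (rule finite_set_of_finite_funs, auto)
qed

section \<open>Admissible supports and finiteness of products\<close>

definition admissible :: "nat \<Rightarrow> gmono set \<Rightarrow> bool" where
  "admissible N S \<longleftrightarrow>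
     (\<forall>m n l. (m, n, l) \<in> S \<longrightarrow> m \<in> zvecs N \<and> n \<in> zvecs N \<and> l \<in> zvecs N)
   \<and> (\<forall>m. finite {(n, l). (m, n, l) \<in> S})
   \<and> (\<exists>F. finite F \<and> (\<forall>m n l. (m, n, l) \<in> S \<longrightarrow> (\<exists>m0\<in>F. (\<lambda>i. m i - m0 i) \<in> ratio_cone N)))"

lemma admissible_subset:
  assumes "admissible N S" "S' \<subseteq> S"
  shows "admissible N S'"
proof -
  have "finite {(n, l). (m, n, l) \<in> S'}" for m
    by (rule finite_subset[of _ "{(n, l). (m, n, l) \<in> S}"])
      (use assms in \<open>auto simp: admissible_def\<close>)
  moreover have "\<exists>F. finite F \<and> (\<forall>m n l. (m, n, l) \<in> S' \<longrightarrow> (\<exists>m0\<in>F. (\<lambda>i. m i - m0 i) \<in> ratio_cone N))"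
    using assms unfolding admissible_def by (meson subsetD)
  moreover have "m \<in> zvecs N \<and> n \<in> zvecs N \<and> l \<in> zvecs N" if "(m, n, l) \<in> S'" for m n l
    using assms that unfolding admissible_def by (meson subsetD)
  ultimately show ?thesis by (simp add: admissible_def)
qed

lemma admissible_Un:
  assumes "admissible N S" "admissible N S'"
  shows "admissible N (S \<union> S')"
proof -
  obtain F F' where "finite F" "finite F'"
    "\<forall>m n l. (m, n, l) \<in> S \<longrightarrow> (\<exists>m0\<in>F. (\<lambda>i. m i - m0 i) \<in> ratio_cone N)"
    "\<forall>m n l. (m, n, l) \<in> S' \<longrightarrow> (\<exists>m0\<in>F'. (\<lambda>i. m i - m0 i) \<in> ratio_cone N)"
    using assms unfolding admissible_def by meson
  then have "\<exists>F. finite F \<and> (\<forall>m n l. (m, n, l) \<in> S \<union> S' \<longrightarrow>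
      (\<exists>m0\<in>F. (\<lambda>i. m i - m0 i) \<in> ratio_cone N))"
    by (intro exI[of _ "F \<union> F'"]) blast
  moreover have "finite {(n, l). (m, n, l) \<in> S \<union> S'}" for m
  proof -
    have "{(n, l). (m, n, l) \<in> S \<union> S'} = {(n, l). (m, n, l) \<in> S} \<union> {(n, l). (m, n, l) \<in> S'}"
      by auto
    then show ?thesis using assms by (simp add: admissible_def)
  qed
  ultimately show ?thesis using assms unfolding admissible_def by blast
qed

text \<open>This makes the sum defining a product finite. After subtracting one of finitely many
  base points from each factor, the two Lambda-exponents split a fixed vector inside the cone; over
  each exponent lie only finitely many pairs \<open>(n, l)\<close>.\<close>

lemma admissible_finite_pairs:
  assumes "admissible N S" "admissible N S'"
  shows "finite {(p, p'). p \<in> S \<and> p' \<in> S' \<and> fst (mono_comp p p') = m}"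
proof -
  obtain F F' where F: "finite F" "finite F'"
    "\<And>m n l. (m, n, l) \<in> S \<Longrightarrow> (\<exists>m0\<in>F. (\<lambda>i. m i - m0 i) \<in> ratio_cone N)"
    "\<And>m n l. (m, n, l) \<in> S' \<Longrightarrow> (\<exists>m0\<in>F'. (\<lambda>i. m i - m0 i) \<in> ratio_cone N)"
    using assms unfolding admissible_def by meson
  define C where "C c = {c1. c1 \<in> ratio_cone N \<and> (\<lambda>i. c i - c1 i) \<in> ratio_cone N}" for c
  \<comment> \<open>\<open>M\<close> collects all possible Lambda-exponents of the first factor; the
    exponent of the second is then \<open>m - m1\<close>, and \<open>P m1\<close> lists the pairs
    over this choice.\<close>
  define M where
    "M = (\<Union>f\<in>F. \<Union>f'\<in>F'. (\<lambda>c1 i. f i + c1 i) ` C (\<lambda>i. m i - f i - f' i))"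
  have "finite M" using F unfolding M_def C_def
    by (intro finite_UN_I finite_imageI finite_ratio_cone_splits)
  have fib: "finite {(n, l). (m1, n, l) \<in> S}" "finite {(n, l). (m1, n, l) \<in> S'}" for m1
    using assms by (auto simp: admissible_def)
  define P where "P m1 = (\<lambda>((n, l), (n', l')). ((m1, n, l), ((\<lambda>i. m i - m1 i), n', l'))) `
     ({(n, l). (m1, n, l) \<in> S} \<times> {(n, l). ((\<lambda>i. m i - m1 i), n, l) \<in> S'})" for m1
  have "finite (P m1)" for m1 using fib unfolding P_def by blast
  then have "finite (\<Union>m1\<in>M. P m1)" using \<open>finite M\<close> by blast
  moreover have "{(p, p'). p \<in> S \<and> p' \<in> S' \<and> fst (mono_comp p p') = m} \<subseteq> (\<Union>m1\<in>M. P m1)"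
  proof safe
    fix m1 n1 l1 m2 n2 l2
    assume p: "(m1, n1, l1) \<in> S" "(m2, n2, l2) \<in> S'"
      and m: "m = fst (mono_comp (m1, n1, l1) (m2, n2, l2))"
    obtain f f' where f: "f \<in> F" "f' \<in> F'"
      "(\<lambda>i. m1 i - f i) \<in> ratio_cone N" "(\<lambda>i. m2 i - f' i) \<in> ratio_cone N"
      using F p by meson
    have "(\<lambda>i. m1 i - f i) \<in> C (\<lambda>i. m i - f i - f' i)"
      using f m by (simp add: C_def algebra_simps)
    then have "m1 \<in> (\<lambda>c1 i. f i + c1 i) ` C (\<lambda>i. m i - f i - f' i)"
      by (rule image_eqI[rotated]) simp
    then have "m1 \<in> M" unfolding M_def using f by blast
    moreover have "((m1, n1, l1), (m2, n2, l2)) \<in> P m1"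
      unfolding P_def using p m
      by (auto intro!: image_eqI[of _ _ "((n1, l1), (n2, l2))"])
    ultimately show "((m1, n1, l1), (m2, n2, l2)) \<in> (\<Union>m1\<in>M. P m1)" by blast
  qed
  ultimately show ?thesis by (rule finite_subset[rotated])
qed

definition mono_comps :: "gmono set \<Rightarrow> gmono set \<Rightarrow> gmono set" where
  "mono_comps S S' = {mono_comp p p' | p p'. p \<in> S \<and> p' \<in> S'}"

lemma admissible_mono_comps:
  assumes "admissible N S" "admissible N S'"
  shows "admissible N (mono_comps S S')"
  unfolding admissible_def
proof (intro conjI allI impI)
  fix m n l assume "(m, n, l) \<in> mono_comps S S'"
  then show "m \<in> zvecs N" "n \<in> zvecs N" "l \<in> zvecs N"
    using assms by (auto simp: mono_comps_def admissible_def)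
next
  fix m
  have "{(n, l). (m, n, l) \<in> mono_comps S S'} \<subseteq> (\<lambda>(p, p'). snd (mono_comp p p')) `
      {(p, p'). p \<in> S \<and> p' \<in> S' \<and> fst (mono_comp p p') = m}"
    unfolding mono_comps_def by (force intro: image_eqI)
  then show "finite {(n, l). (m, n, l) \<in> mono_comps S S'}"
    by (rule finite_subset) (rule finite_imageI[OF admissible_finite_pairs[OF assms]])
next
  obtain F F' where F: "finite F" "finite F'"
    "\<And>m n l. (m, n, l) \<in> S \<Longrightarrow> (\<exists>m0\<in>F. (\<lambda>i. m i - m0 i) \<in> ratio_cone N)"
    "\<And>m n l. (m, n, l) \<in> S' \<Longrightarrow> (\<exists>m0\<in>F'. (\<lambda>i. m i - m0 i) \<in> ratio_cone N)"
    using assms unfolding admissible_def by meson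
  show "\<exists>F. finite F \<and> (\<forall>m n l. (m, n, l) \<in> mono_comps S S' \<longrightarrow>
      (\<exists>m0\<in>F. (\<lambda>i. m i - m0 i) \<in> ratio_cone N))"
  proof (intro exI conjI allI impI)
    show "finite ((\<lambda>(f, f') i. f i + f' i) ` (F \<times> F'))" using F by blast
    fix m n l assume "(m, n, l) \<in> mono_comps S S'"
    then obtain m1 n1 l1 m2 n2 l2 where p: "(m1, n1, l1) \<in> S" "(m2, n2, l2) \<in> S'"
      and m: "m = (\<lambda>i. m1 i + m2 i)"
      by (auto simp: mono_comps_def)
    obtain f f' where f: "f \<in> F" "f' \<in> F'"
      "(\<lambda>i. m1 i - f i) \<in> ratio_cone N" "(\<lambda>i. m2 i - f' i) \<in> ratio_cone N"
      using F p by meson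
    have "(\<lambda>i. m i - (f i + f' i)) \<in> ratio_cone N"
      using ratio_cone_add[OF f(3,4)] m by (simp add: algebra_simps)
    then show "\<exists>m0\<in>(\<lambda>(f, f') i. f i + f' i) ` (F \<times> F'). (\<lambda>i. m i - m0 i) \<in> ratio_cone N"
      using f by (intro bexI[of _ "\<lambda>i. f i + f' i"]) auto
  qed
qed

lemma mono_comp_assoc:
  "mono_comp (mono_comp p1 p2) p3 = mono_comp p1 (mono_comp p2 p3)"
  by (cases p1; cases p2; cases p3) (simp add: algebra_simps)

text \<open>The 2-cocycle identity for the twist: it is what makes the twisted multiplication of
  monomials associative.\<close>

lemma mono_twist_cocycle:
  "mono_twist N p1 p2 + mono_twist N (mono_comp p1 p2) p3
     = mono_twist N p2 p3 + mono_twist N p1 (mono_comp p2 p3)"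
  by (cases p1; cases p2; cases p3)
    (simp add: sum.distrib[symmetric] power2_eq_square algebra_simps)

section \<open>The ring structure of the completed quantum torus\<close>

locale qtorus_ring =
  fixes N :: nat and s :: complex and R :: "(complex, gmono \<Rightarrow> complex) module" (structure)
  assumes s_nonzero: "s \<noteq> 0" and R_def: "R = qtorus N s"
begin

lemma carrier_iff: "x \<in> carrier R \<longleftrightarrow> admissible N {p. x p \<noteq> 0}"
  by (simp add: R_def qtorus_def admissible_def)

lemma zero_eq: "\<zero> = (\<lambda>p. 0)"
  and one_eq: "\<one> = qmono (\<lambda>i. 0, \<lambda>i. 0, \<lambda>i. 0)"
  and add_eq: "x \<oplus> y = (\<lambda>p. x p + y p)"
  and smult_eq: "c \<odot> x = (\<lambda>p. c * x p)"
  by (auto simp: R_def qtorus_def qmono_def)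

definition comp_pairs :: "gmono set \<Rightarrow> gmono set \<Rightarrow> gmono \<Rightarrow> (gmono \<times> gmono) set" where
  "comp_pairs S S' p = {(p1, p2). p1 \<in> S \<and> p2 \<in> S' \<and> mono_comp p1 p2 = p}"

lemma finite_comp_pairs:
  assumes "admissible N S" "admissible N S'"
  shows "finite (comp_pairs S S' p)"
  using admissible_finite_pairs[OF assms, of "fst p"]
  by (rule finite_subset[rotated]) (auto simp: comp_pairs_def)

text \<open>The product is defined as a sum over the exact supports, which change when elements are
  added or multiplied. Admissible supersets as index sets let several products be compared term by
  term.\<close>

lemma mult_eq:
  assumes "admissible N S" "admissible N S'" "{p. x p \<noteq> 0} \<subseteq> S" "{p. y p \<noteq> 0} \<subseteq> S'"
  shows "(x \<otimes> y) p
    = (\<Sum>(p1, p2)\<in>comp_pairs S S' p. s powi mono_twist N p1 p2 * x p1 * y p2)"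
  unfolding R_def qtorus_def monoid.simps
proof (rule sum.mono_neutral_left[OF finite_comp_pairs[OF assms(1,2)]])
  show "{(p1, p2). x p1 \<noteq> 0 \<and> y p2 \<noteq> 0 \<and> mono_comp p1 p2 = p} \<subseteq> comp_pairs S S' p"
    unfolding comp_pairs_def using assms(3,4) by blast
qed (auto simp: comp_pairs_def simp del: mono_comp.simps)

lemma mult_nonzeroD:
  assumes "(x \<otimes> y) p \<noteq> 0"
  shows "\<exists>p1 p2. x p1 \<noteq> 0 \<and> y p2 \<noteq> 0 \<and> mono_comp p1 p2 = p"
proof (rule ccontr)
  assume "\<not> ?thesis"
  then have *: "{(p1, p2). x p1 \<noteq> 0 \<and> y p2 \<noteq> 0 \<and> mono_comp p1 p2 = p} = {}" by blast
  show False using assms unfolding R_def qtorus_def monoid.simps * by simp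
qed

lemma mult_support: "{p. (x \<otimes> y) p \<noteq> 0} \<subseteq> mono_comps {p. x p \<noteq> 0} {p. y p \<noteq> 0}"
proof
  fix p assume "p \<in> {p. (x \<otimes> y) p \<noteq> 0}"
  then obtain p1 p2 where "x p1 \<noteq> 0" "y p2 \<noteq> 0" "mono_comp p1 p2 = p"
    using mult_nonzeroD by blast
  then show "p \<in> mono_comps {p. x p \<noteq> 0} {p. y p \<noteq> 0}"
    unfolding mono_comps_def by blast
qed

lemma mult_closed: "x \<in> carrier R \<Longrightarrow> y \<in> carrier R \<Longrightarrow> x \<otimes> y \<in> carrier R"
  unfolding carrier_iff by (rule admissible_subset[OF admissible_mono_comps mult_support])

lemma add_closed: "x \<in> carrier R \<Longrightarrow> y \<in> carrier R \<Longrightarrow> x \<oplus> y \<in> carrier R"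
  unfolding carrier_iff add_eq
  by (rule admissible_subset[OF admissible_Un[of N "{p. x p \<noteq> 0}" "{p. y p \<noteq> 0}"]]) auto

lemma smult_closed [simp]: "x \<in> carrier R \<Longrightarrow> c \<odot> x \<in> carrier R"
  unfolding carrier_iff smult_eq by (erule admissible_subset) auto

lemma zero_closed: "\<zero> \<in> carrier R"
  by (auto simp: carrier_iff admissible_def zero_eq intro: exI[of _ "{}"])

lemma qmono_closed [simp]:
  "m \<in> zvecs N \<Longrightarrow> n \<in> zvecs N \<Longrightarrow> l \<in> zvecs N \<Longrightarrow> qmono (m, n, l) \<in> carrier R"
  by (simp add: R_def qmono_carrier)

text \<open>Both sides expand into sums over factorisations of \<open>p\<close> into three
  monomials. Regrouping is a bijection between the index sets, and the powers of \<open>s\<close>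
  agree by \<open>mono_twist_cocycle\<close>.\<close>

lemma mult_assoc:
  assumes "x \<in> carrier R" "y \<in> carrier R" "z \<in> carrier R"
  shows "x \<otimes> y \<otimes> z = x \<otimes> (y \<otimes> z)"
proof
  fix p
  define X Y Z where "X = {p. x p \<noteq> 0}" and "Y = {p. y p \<noteq> 0}" and "Z = {p. z p \<noteq> 0}"
  have adm: "admissible N X" "admissible N Y" "admissible N Z"
    using assms by (simp_all add: X_def Y_def Z_def carrier_iff)
  note admc = admissible_mono_comps[OF adm(1,2)] admissible_mono_comps[OF adm(2,3)]
  \<comment> \<open>Only inclusions hold here, since cancellation may shrink the support of a
    product; \<open>mult_eq\<close> accepts the larger sets.\<close>
  have supp: "{p. (x \<otimes> y) p \<noteq> 0} \<subseteq> mono_comps X Y" "{p. (y \<otimes> z) p \<noteq> 0} \<subseteq> mono_comps Y Z"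
    using mult_support by (simp_all add: X_def Y_def Z_def)
  \<comment> \<open>\<open>A\<close> indexes the bracketing \<open>(p1 p2) p3\<close> and
    \<open>B\<close> the bracketing \<open>p1 (p2 p3)\<close>. The intermediate product is kept as a
    redundant component so that each set is a dependent sum.\<close>
  define A where "A = (SIGMA (p12, p3):comp_pairs (mono_comps X Y) Z p. comp_pairs X Y p12)"
  define B where "B = (SIGMA (p1, p23):comp_pairs X (mono_comps Y Z) p. comp_pairs Y Z p23)"
  have A: "((p12, p3), (p1, p2)) \<in> A \<longleftrightarrow> p1 \<in> X \<and> p2 \<in> Y \<and> p3 \<in> Z \<and>
      p12 = mono_comp p1 p2 \<and> mono_comp p1 (mono_comp p2 p3) = p" for p12 p3 p1 p2
    unfolding A_def comp_pairs_def mono_comps_def mem_Sigma_iff mem_Collect_eq prod.case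
    using mono_comp_assoc by metis
  have B: "((p1, p23), (p2, p3)) \<in> B \<longleftrightarrow> p1 \<in> X \<and> p2 \<in> Y \<and> p3 \<in> Z \<and>
      p23 = mono_comp p2 p3 \<and> mono_comp p1 (mono_comp p2 p3) = p" for p23 p3 p1 p2
    unfolding B_def comp_pairs_def mono_comps_def mem_Sigma_iff mem_Collect_eq prod.case
    by metis
  define j :: "(gmono \<times> gmono) \<times> (gmono \<times> gmono) \<Rightarrow> _" where
    "j = (\<lambda>((p12, p3), (p1, p2)). ((p1, mono_comp p2 p3), (p2, p3)))"
  define i :: "(gmono \<times> gmono) \<times> (gmono \<times> gmono) \<Rightarrow> _" where
    "i = (\<lambda>((p1, p23), (p2, p3)). ((mono_comp p1 p2, p3), (p1, p2)))"
  have "(x \<otimes> y \<otimes> z) p = (\<Sum>(p12, p3)\<in>comp_pairs (mono_comps X Y) Z p. \<Sum>(p1, p2)\<in>comp_pairs X Y p12.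
      s powi mono_twist N p12 p3 * (s powi mono_twist N p1 p2 * x p1 * y p2) * z p3)"
    by (subst mult_eq[OF admc(1) adm(3) supp(1)], simp add: Z_def)
      (auto intro!: sum.cong simp: sum_distrib_left sum_distrib_right X_def Y_def
        mult_eq[OF adm(1,2), of x y] case_prod_unfold)
  also have "\<dots> = (\<Sum>((p12, p3), (p1, p2))\<in>A.
      s powi mono_twist N p12 p3 * (s powi mono_twist N p1 p2 * x p1 * y p2) * z p3)"
    unfolding A_def case_prod_unfold
    by (subst sum.Sigma) (auto intro!: finite_comp_pairs adm admc simp: case_prod_unfold)
  also have "\<dots> = (\<Sum>((p1, p23), (p2, p3))\<in>B.
      s powi mono_twist N p1 p23 * x p1 * (s powi mono_twist N p2 p3 * y p2 * z p3))"
  proof (rule sum.reindex_bij_witness[where i = i and j = j])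
    fix w assume w: "w \<in> A"
    obtain p12 p3 p1 p2 where [simp]: "w = ((p12, p3), (p1, p2))" by (metis surj_pair)
    have wA: "p1 \<in> X" "p2 \<in> Y" "p3 \<in> Z" "p12 = mono_comp p1 p2"
      "mono_comp p1 (mono_comp p2 p3) = p"
      using w by (simp_all only: \<open>w = _\<close> A)
    show "i (j w) = w" using wA by (simp add: i_def j_def)
    show "j w \<in> B" using wA by (simp only: \<open>w = _\<close> prod.case j_def B)
    have "s powi mono_twist N p12 p3 * s powi mono_twist N p1 p2
        = s powi mono_twist N p1 (mono_comp p2 p3) * s powi mono_twist N p2 p3"
      using mono_twist_cocycle[of N p1 p2 p3] s_nonzero wA(4)
      by (metis power_int_add add.commute)
    then show "(\<lambda>((p1, p23), (p2, p3)).
        s powi mono_twist N p1 p23 * x p1 * (s powi mono_twist N p2 p3 * y p2 * z p3)) (j w)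
      = (\<lambda>((p12, p3), (p1, p2)).
        s powi mono_twist N p12 p3 * (s powi mono_twist N p1 p2 * x p1 * y p2) * z p3) w"
      by (simp add: j_def algebra_simps)
  next
    fix w assume w: "w \<in> B"
    obtain p23 p3 p1 p2 where [simp]: "w = ((p1, p23), (p2, p3))" by (metis surj_pair)
    have wB: "p1 \<in> X" "p2 \<in> Y" "p3 \<in> Z" "p23 = mono_comp p2 p3"
      "mono_comp p1 (mono_comp p2 p3) = p"
      using w by (simp_all only: \<open>w = _\<close> B)
    show "j (i w) = w" using wB by (simp add: i_def j_def)
    show "i w \<in> A" using wB by (simp only: \<open>w = _\<close> prod.case i_def A)
  qed
  also have "\<dots> = (\<Sum>(p1, p23)\<in>comp_pairs X (mono_comps Y Z) p. \<Sum>(p2, p3)\<in>comp_pairs Y Z p23.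
      s powi mono_twist N p1 p23 * x p1 * (s powi mono_twist N p2 p3 * y p2 * z p3))"
    unfolding B_def case_prod_unfold
    by (subst sum.Sigma) (auto intro!: finite_comp_pairs adm admc simp: case_prod_unfold)
  also have "\<dots> = (x \<otimes> (y \<otimes> z)) p"
    by (subst mult_eq[OF adm(1) admc(2) _ supp(2)], simp add: X_def)
      (auto intro!: sum.cong simp: sum_distrib_left sum_distrib_right Z_def Y_def
        mult_eq[OF adm(2,3), of y z] case_prod_unfold)
  finally show "(x \<otimes> y \<otimes> z) p = (x \<otimes> (y \<otimes> z)) p" .
qed

text \<open>Composition with a fixed monomial is injective, so exactly one monomial of
  \<open>x\<close> can contribute to a given coefficient.\<close>

lemma qmono_mult_left:
  "(qmono (m1, n1, l1) \<otimes> x) (m, n, l) =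
     s powi mono_twist N (m1, n1, l1) (\<lambda>i. m i - m1 i, \<lambda>i. n i - n1 i - l1 i * (m i - m1 i), \<lambda>i. l i - l1 i)
      * x (\<lambda>i. m i - m1 i, \<lambda>i. n i - n1 i - l1 i * (m i - m1 i), \<lambda>i. l i - l1 i)"
proof -
  let ?p = "(m1, n1, l1)"
  let ?p' = "(\<lambda>i. m i - m1 i, \<lambda>i. n i - n1 i - l1 i * (m i - m1 i), \<lambda>i. l i - l1 i)"
  have *: "mono_comp ?p (m', n', l') = (m, n, l) \<longleftrightarrow> (m', n', l') = ?p'" for m' n' l'
    by (auto simp: algebra_simps)
  have "mono_comp ?p p2 = (m, n, l) \<longleftrightarrow> p2 = ?p'" for p2
    by (cases p2) (simp only: *)
  then have "{(p1, p2). qmono ?p p1 \<noteq> 0 \<and> x p2 \<noteq> 0 \<and> mono_comp p1 p2 = (m, n, l)}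
      = (if x ?p' = 0 then {} else {(?p, ?p')})"
    by (auto simp: qmono_def simp del: mono_comp.simps split: if_splits)
  then show ?thesis
    unfolding R_def qtorus_def monoid.simps by (simp add: qmono_def)
qed

lemma qmono_mult_right:
  "(x \<otimes> qmono (m2, n2, l2)) (m, n, l) =
     s powi mono_twist N (\<lambda>i. m i - m2 i, \<lambda>i. n i - n2 i - (l i - l2 i) * m2 i, \<lambda>i. l i - l2 i) (m2, n2, l2)
      * x (\<lambda>i. m i - m2 i, \<lambda>i. n i - n2 i - (l i - l2 i) * m2 i, \<lambda>i. l i - l2 i)"
proof -
  let ?p = "(m2, n2, l2)"
  let ?p' = "(\<lambda>i. m i - m2 i, \<lambda>i. n i - n2 i - (l i - l2 i) * m2 i, \<lambda>i. l i - l2 i)"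
  have *: "mono_comp (m', n', l') ?p = (m, n, l) \<longleftrightarrow> (m', n', l') = ?p'" for m' n' l'
    by (auto simp: algebra_simps)
  have "mono_comp p1 ?p = (m, n, l) \<longleftrightarrow> p1 = ?p'" for p1
    by (cases p1) (simp only: *)
  then have "{(p1, p2). x p1 \<noteq> 0 \<and> qmono ?p p2 \<noteq> 0 \<and> mono_comp p1 p2 = (m, n, l)}
      = (if x ?p' = 0 then {} else {(?p', ?p)})"
    by (auto simp: qmono_def simp del: mono_comp.simps split: if_splits)
  then show ?thesis
    unfolding R_def qtorus_def monoid.simps by (simp add: qmono_def)
qed

lemma one_mult: "\<one> \<otimes> x = x" "x \<otimes> \<one> = x"
  by (auto simp: one_eq qmono_mult_left qmono_mult_right fun_eq_iff)

lemma add_mult: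
  assumes "x \<in> carrier R" "y \<in> carrier R" "z \<in> carrier R"
  shows "(x \<oplus> y) \<otimes> z = x \<otimes> z \<oplus> y \<otimes> z" "z \<otimes> (x \<oplus> y) = z \<otimes> x \<oplus> z \<otimes> y"
proof -
  let ?S = "{p. x p \<noteq> 0} \<union> {p. y p \<noteq> 0}" and ?Z = "{p. z p \<noteq> 0}"
  have adm: "admissible N ?S" "admissible N ?Z"
    using assms by (simp_all add: carrier_iff admissible_Un)
  show "(x \<oplus> y) \<otimes> z = x \<otimes> z \<oplus> y \<otimes> z"
    unfolding add_eq
    by (rule ext, (subst mult_eq[OF adm], auto)+)
      (simp add: case_prod_unfold algebra_simps sum.distrib)
  show "z \<otimes> (x \<oplus> y) = z \<otimes> x \<oplus> z \<otimes> y"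
    unfolding add_eq
    by (rule ext, (subst mult_eq[OF adm(2,1)], auto)+)
      (simp add: case_prod_unfold algebra_simps sum.distrib)
qed

lemma smult_mult [simp]: "(c \<odot> x) \<otimes> y = c \<odot> (x \<otimes> y)" "x \<otimes> (c \<odot> y) = c \<odot> (x \<otimes> y)"
proof -
  show "(c \<odot> x) \<otimes> y = c \<odot> (x \<otimes> y)"
    by (cases "c = 0")
      (auto simp: R_def qtorus_def sum_distrib_left case_prod_unfold mult_ac)
  show "x \<otimes> (c \<odot> y) = c \<odot> (x \<otimes> y)"
    by (cases "c = 0")
      (auto simp: R_def qtorus_def sum_distrib_left case_prod_unfold mult_ac)
qed

lemma smult_simps [simp]:
  "c \<odot> (d \<odot> x) = (c * d) \<odot> x" "1 \<odot> x = x" "c \<odot> \<zero> = \<zero>"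
  by (simp_all add: smult_eq zero_eq mult_ac)

lemma qtorus_abelian_group: "abelian_group R"
proof (rule abelian_groupI)
  fix x assume x: "x \<in> carrier R"
  have "(- 1) \<odot> x \<oplus> x = \<zero>" by (simp add: add_eq smult_eq zero_eq)
  then show "\<exists>y\<in>carrier R. y \<oplus> x = \<zero>"
    using smult_closed[OF x] by blast
qed (simp_all only: add_closed zero_closed, simp_all add: add_eq zero_eq add_ac)

lemma qtorus_monoid: "monoid R"
proof (rule monoidI)
  show "\<one> \<in> carrier R" by (simp add: one_eq)
qed (simp_all only: mult_closed one_mult mult_assoc)

sublocale ring R
  by (rule ringI[OF qtorus_abelian_group qtorus_monoid]) (simp_all only: add_mult)

lemma uminus_eq: "x \<in> carrier R \<Longrightarrow> \<ominus> x = (- 1) \<odot> x"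
  by (rule minus_equality) (auto, auto simp: add_eq smult_eq zero_eq)

lemma minus_eq: "x \<in> carrier R \<Longrightarrow> y \<in> carrier R \<Longrightarrow> x \<ominus> y = (\<lambda>p. x p - y p)"
  by (simp add: a_minus_def uminus_eq) (simp add: add_eq smult_eq)

end

section \<open>Reduction to linear equations\<close>

lemma (in monoid) units_of_int_pow:
  assumes "x \<in> Units G"
  shows "x [^]\<^bsub>units_of G\<^esub> (k::int) = x [^] k"
proof -
  have "x [^] n \<in> Units G" for n :: nat
    using assms by (induction n) auto
  then show ?thesis
    using assms by (simp add: int_pow_def2 units_of_pow units_of_inv del: pow_nat)
qed

lemma (in monoid) Units_int_pow_closed [simp]:
  assumes "x \<in> Units G"
  shows "x [^] (k::int) \<in> Units G"
  using assms group.int_pow_closed[OF units_group, of x k]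
  by (simp add: units_of_carrier units_of_int_pow)

lemma (in monoid) Units_int_pow_add:
  assumes "x \<in> Units G"
  shows "x [^] (j + k::int) = x [^] j \<otimes> x [^] k"
  using assms group.int_pow_mult[OF units_group, of x j k]
  by (simp add: units_of_carrier units_of_int_pow units_of_mult)

lemma (in monoid) Units_int_pow_simps [simp]:
  assumes "x \<in> Units G"
  shows "x [^] (1::int) = x" "x [^] (- 1::int) = inv x"
  using assms by (auto simp: int_pow_def2)

lemma (in monoid) ordered_prod_Suc:
  assumes "\<And>i. i \<in> {1..Suc a} \<Longrightarrow> f i \<in> carrier G"
  shows "ordered_prod G f (Suc a) = ordered_prod G f a \<otimes> f (Suc a)"
    and "ordered_prod G f a \<in> carrier G"
proof -
  \<comment> \<open>The fold associates to the right, so the last factor sits innermost.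
    Generalising over the start value \<open>z\<close> lets it be pulled out on the right.\<close>
  have *: "foldr (\<lambda>i x. f i \<otimes> x) xs z = foldr (\<lambda>i x. f i \<otimes> x) xs \<one> \<otimes> z
      \<and> foldr (\<lambda>i x. f i \<otimes> x) xs \<one> \<in> carrier G"
    if "set xs \<subseteq> {1..Suc a}" "z \<in> carrier G" for xs z
    using that by (induction xs) (auto simp: assms m_assoc)
  have upt: "[1..<Suc a + 1] = [1..<a + 1] @ [Suc a]" "set [1..<a + 1] \<subseteq> {1..Suc a}"
    by auto
  have fa: "f (Suc a) \<in> carrier G" using assms by simp
  show "ordered_prod G f (Suc a) = ordered_prod G f a \<otimes> f (Suc a)"
    using *[OF upt(2) fa] fa unfolding ordered_prod_def upt(1) by simp
  show "ordered_prod G f a \<in> carrier G"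
    using *[OF upt(2) one_closed] unfolding ordered_prod_def by blast
qed

section \<open>Monomials of the initial data\<close>

definition eps_upto :: "nat \<Rightarrow> zvec" where
  "eps_upto a = (\<lambda>i. if i \<in> {1..a} then 1 else 0)"

lemma eps_upto_0 [simp]: "eps_upto 0 = (\<lambda>i. 0)"
  by (simp add: eps_upto_def)

lemma eps_upto_Suc: "eps_upto (Suc a) = (\<lambda>i. eps_upto a i + eps (Suc a) i)"
  by (auto simp: eps_upto_def eps_def)

lemma eps_upto_zvecs [simp]: "a \<le> N \<Longrightarrow> eps_upto a \<in> zvecs N"
  by (auto simp: zvecs_def eps_upto_def)

lemma eps_zvecs [simp]: "a \<in> {1..N} \<Longrightarrow> eps a \<in> zvecs N"
  by (auto simp: zvecs_def eps_def)

lemma sum_eps_upto: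
  assumes "a \<le> N"
  shows "(\<Sum>i\<in>{1..N}. f i * eps_upto a i) = psum f a"
  unfolding psum_def using assms
  by (intro sum.mono_neutral_cong_right) (auto simp: eps_upto_def)

lemma eps_upto_square [simp]: "(eps_upto a i)\<^sup>2 = eps_upto a i"
  by (simp add: eps_upto_def)

lemma psum_eps_upto: "psum (eps_upto a) b = int (min a b)"
  by (induction b) (auto simp: eps_upto_def)

definition Lam_prod :: "nat \<Rightarrow> gmono \<Rightarrow> complex" where
  "Lam_prod a = qmono (eps_upto a, \<lambda>i. 0, \<lambda>i. 0)"

definition LamT_prod :: "nat \<Rightarrow> gmono \<Rightarrow> complex" where
  "LamT_prod a = qmono (eps_upto a, eps_upto a, \<lambda>i. 0)"

context qtorus_ring
begin

lemma qmono_mult_qmono: "qmono p1 \<otimes> qmono p2 = (s powi mono_twist N p1 p2) \<odot> qmono (mono_comp p1 p2)"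
  by (simp add: R_def qmono_mult)

lemma Lam_prod_0 [simp]: "Lam_prod 0 = \<one>"
  by (simp add: Lam_prod_def one_eq)

lemma Lam_prod_closed [simp]: "a \<le> N \<Longrightarrow> Lam_prod a \<in> carrier R"
  by (simp add: Lam_prod_def)

lemma LamT_prod_closed [simp]: "a \<le> N \<Longrightarrow> LamT_prod a \<in> carrier R"
  by (simp add: LamT_prod_def)

lemma Lam_closed: "a \<in> {1..N} \<Longrightarrow> Lam a \<in> carrier R"
  and Tgen_closed: "a \<in> {1..N} \<Longrightarrow> Tgen a \<in> carrier R"
  by (simp_all add: Lam_def Tgen_def)

lemma Lam_prod_mult:
  "Lam_prod a \<otimes> Lam_prod b = qmono (\<lambda>i. eps_upto a i + eps_upto b i, \<lambda>i. 0, \<lambda>i. 0)"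
  by (simp add: Lam_prod_def qmono_mult_qmono)

lemma ordered_prod_Lam: "a \<le> N \<Longrightarrow> ordered_prod R Lam a = Lam_prod a"
proof (induction a)
  case 0
  show ?case by (simp add: ordered_prod_def)
next
  case (Suc a)
  have "ordered_prod R Lam (Suc a) = Lam_prod a \<otimes> Lam (Suc a)"
    using Suc by (subst ordered_prod_Suc) (simp_all add: Lam_closed)
  also have "\<dots> = Lam_prod (Suc a)"
    by (simp add: Lam_prod_def Lam_def qmono_mult_qmono eps_upto_Suc)
  finally show ?case .
qed

lemma ordered_prod_Tgen:
  "a \<le> N \<Longrightarrow> ordered_prod R Tgen a = qmono (\<lambda>i. 0, eps_upto a, \<lambda>i. 0)"
proof (induction a)
  case 0
  show ?case by (simp add: ordered_prod_def one_eq)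
next
  case (Suc a)
  have "ordered_prod R Tgen (Suc a) = qmono (\<lambda>i. 0, eps_upto a, \<lambda>i. 0) \<otimes> Tgen (Suc a)"
    using Suc by (subst ordered_prod_Suc) (simp_all add: Tgen_closed)
  also have "\<dots> = qmono (\<lambda>i. 0, eps_upto (Suc a), \<lambda>i. 0)"
    by (simp add: Tgen_def qmono_mult_qmono eps_upto_Suc)
  finally show ?case .
qed

lemma ordered_prod_LamT:
  "a \<le> N \<Longrightarrow> ordered_prod R Lam a \<otimes> ordered_prod R Tgen a = LamT_prod a"
  by (simp add: ordered_prod_Lam ordered_prod_Tgen Lam_prod_def LamT_prod_def qmono_mult_qmono)

text \<open>Only \<open>T_i\<close> and \<open>Lambda_i\<close> with the same index fail to commute.
  Each of the \<open>min a b\<close> common indices contributes one factor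
  \<open>q = s^2\<close>.\<close>

lemma LamT_prod_commute:
  assumes "a \<le> N" "b \<le> N"
  shows "LamT_prod b \<otimes> Lam_prod a = (s\<^sup>2 powi int (min a b)) \<odot> (Lam_prod a \<otimes> LamT_prod b)"
proof -
  have "mono_twist N (eps_upto b, eps_upto b, \<lambda>i. 0) (eps_upto a, \<lambda>i. 0, \<lambda>i. 0)
      = psum (\<lambda>i. 2 * eps_upto b i) a"
    using sum_eps_upto[OF assms(1), of "\<lambda>i. 2 * eps_upto b i"] by simp
  also have "\<dots> = 2 * int (min a b)"
    by (simp add: psum_mult psum_eps_upto min.commute)
  finally have "s powi mono_twist N (eps_upto b, eps_upto b, \<lambda>i. 0) (eps_upto a, \<lambda>i. 0, \<lambda>i. 0)
      = s\<^sup>2 powi int (min a b)"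
    by (simp only: power_int_mult) (simp only: power_int_numeral)
  then show ?thesis
    unfolding Lam_prod_def LamT_prod_def qmono_mult_qmono by (simp add: add.commute)
qed

text \<open>The right-hand side of the quadratic relation at \<open>k = 0\<close>. The case
  \<open>a = N\<close> encodes the boundary value 0 at index \<open>N + 1\<close>, which
  \<open>Lam_prod\<close> does not produce; the boundary value 1 at index 0 is
  \<open>Lam_prod 0\<close>.\<close>

definition Q_rhs :: "nat \<Rightarrow> gmono \<Rightarrow> complex" where
  "Q_rhs a = Lam_prod a \<otimes> Lam_prod a \<ominus> (if a = N then \<zero> else Lam_prod (a + 1) \<otimes> Lam_prod (a - 1))"

lemma Q_rhs_closed [simp]: "a \<le> N \<Longrightarrow> Q_rhs a \<in> carrier R"
  by (simp add: Q_rhs_def)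

section \<open>Conjugation by integer powers of a unit\<close>

definition conj_pow :: "(gmono \<Rightarrow> complex) \<Rightarrow> int \<Rightarrow> (gmono \<Rightarrow> complex) \<Rightarrow> (gmono \<Rightarrow> complex)" where
  "conj_pow g k x = g [^] k \<otimes> x \<otimes> g [^] (- k)"

context
  fixes g assumes g: "g \<in> Units R"
begin

lemma g_closed [simp]: "g \<in> carrier R" "g [^] (k::int) \<in> carrier R" "inv g \<in> carrier R"
  using g by (auto intro: Units_closed)

lemma pow_cancel [simp]:
  "x \<in> carrier R \<Longrightarrow> g [^] (- k::int) \<otimes> (g [^] k \<otimes> x) = x"
  "x \<in> carrier R \<Longrightarrow> g [^] (k::int) \<otimes> (g [^] (- k) \<otimes> x) = x"
  by (simp_all add: m_assoc[symmetric] Units_int_pow_add[OF g, symmetric])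

lemma conj_pow_closed [simp]: "x \<in> carrier R \<Longrightarrow> conj_pow g k x \<in> carrier R"
  by (simp add: conj_pow_def)

lemma conj_pow_mult:
  "x \<in> carrier R \<Longrightarrow> y \<in> carrier R \<Longrightarrow> conj_pow g k (x \<otimes> y) = conj_pow g k x \<otimes> conj_pow g k y"
  by (simp add: conj_pow_def m_assoc)

lemma conj_pow_smult [simp]: "conj_pow g k (c \<odot> x) = c \<odot> conj_pow g k x"
  by (simp add: conj_pow_def)

lemma conj_pow_one [simp]: "conj_pow g k \<one> = \<one>"
  using pow_cancel(2)[of \<one> k] by (simp add: conj_pow_def)

lemma conj_pow_zero [simp]: "conj_pow g k \<zero> = \<zero>"
  by (simp add: conj_pow_def)

lemma conj_pow_diff:
  "x \<in> carrier R \<Longrightarrow> y \<in> carrier R \<Longrightarrow> conj_pow g k (x \<ominus> y) = conj_pow g k x \<ominus> conj_pow g k y"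
  by (simp add: conj_pow_def a_minus_def r_distr l_distr r_minus l_minus)

lemma conj_pow_add: "x \<in> carrier R \<Longrightarrow> conj_pow g (j + k) x = conj_pow g j (conj_pow g k x)"
proof -
  have "- (j + k) = - k + - j" by simp
  then show "conj_pow g (j + k) x = conj_pow g j (conj_pow g k x)" if "x \<in> carrier R"
    using that unfolding conj_pow_def
    by (simp only: Units_int_pow_add[OF g] m_assoc g_closed m_closed)
qed

lemma conj_pow_0 [simp]: "x \<in> carrier R \<Longrightarrow> conj_pow g 0 x = x"
  by (simp add: conj_pow_def)

end

text \<open>The first equation is the conjugation formula at \<open>k = 1\<close>. The second is the
  quadratic relation at \<open>k = 0\<close>, multiplied by \<open>g\<close> on the left to clear
  the inverse.\<close>

lemma generates_Q_solution_imp_linear: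
  assumes "generates_Q_solution N (s\<^sup>2) s g" "a \<in> {1..N}"
  shows "g \<otimes> Lam_prod a = (s ^ a) \<odot> (LamT_prod a \<otimes> g)"
    and "(s ^ (3 * a)) \<odot> (Lam_prod a \<otimes> g \<otimes> LamT_prod a) = g \<otimes> Q_rhs a"
proof -
  obtain D where g: "g \<in> Units R" and Q: "opposite_quantum_Q_system R N (s\<^sup>2) D"
    and Dk: "\<forall>a\<in>{1..N}. \<forall>k::int. D a k = (s powi (- (int a * k))) \<odot> (g [^] k \<otimes> D a 0 \<otimes> g [^] (- k))"
    and D0: "\<forall>a\<in>{1..N}. D a 0 = ordered_prod R Lam a"
    and D1: "\<forall>a\<in>{1..N}. D a 1 = ordered_prod R Lam a \<otimes> ordered_prod R Tgen a"
    using assms(1) unfolding generates_Q_solution_def R_def by blast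
  note [simp] = g_closed[OF g] Units_l_inv[OF g] Units_r_inv[OF g]
  have aN: "a \<le> N" using assms by simp
  have D0': "D b 0 = Lam_prod b" if "b \<le> N" for b
    using that D0 Q
    by (cases "b = 0") (auto simp: ordered_prod_Lam opposite_quantum_Q_system_def)
  have D1': "D a 1 = LamT_prod a"
    using D1 assms(2) by (auto simp: ordered_prod_LamT)
  have K: "LamT_prod a = (s powi (- int a)) \<odot> (g \<otimes> Lam_prod a \<otimes> inv g)"
    using Dk[rule_format, OF assms(2), of 1] g by (simp add: D1' D0' aN)
  \<comment> \<open>The factor \<open>s ^ a\<close> found here and the factor
    \<open>q ^ a = s ^ (2 * a)\<close> of the quadratic relation combine to
    \<open>s ^ (3 * a)\<close>.\<close>
  have Dm: "D a (- 1) = (s ^ a) \<odot> (inv g \<otimes> Lam_prod a \<otimes> g)"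
    using Dk[rule_format, OF assms(2), of "- 1"] g by (simp add: D0' aN)
  show "g \<otimes> Lam_prod a = (s ^ a) \<odot> (LamT_prod a \<otimes> g)"
    unfolding K using aN s_nonzero by (simp add: m_assoc power_int_minus)
  have "(s\<^sup>2) ^ a \<odot> (D a (0 - 1) \<otimes> D a (0 + 1)) = D a 0 [^] (2::nat) \<ominus> D (a + 1) 0 \<otimes> D (a - 1) 0"
    using Q assms(2) unfolding opposite_quantum_Q_system_def by blast
  also have "D a 0 [^] (2::nat) \<ominus> D (a + 1) 0 \<otimes> D (a - 1) 0 = Q_rhs a"
  proof -
    have "D (a + 1) 0 = (if a = N then \<zero> else Lam_prod (a + 1))"
      using D0'[of "a + 1"] aN Q by (auto simp: opposite_quantum_Q_system_def)
    then show ?thesis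
      using aN by (simp add: Q_rhs_def D0' numeral_2_eq_2)
  qed
  finally have "g \<otimes> Q_rhs a = g \<otimes> ((s ^ (3 * a)) \<odot> (inv g \<otimes> Lam_prod a \<otimes> g \<otimes> LamT_prod a))"
    by (simp add: Dm D1' power_mult[symmetric] power_add[symmetric] mult.commute)
  also have "\<dots> = (s ^ (3 * a)) \<odot> (Lam_prod a \<otimes> g \<otimes> LamT_prod a)"
  proof -
    have "g \<otimes> (inv g \<otimes> x) = x" if "x \<in> carrier R" for x
      using that by (simp add: m_assoc[symmetric])
    then show ?thesis using aN by (simp add: m_assoc)
  qed
  finally show "(s ^ (3 * a)) \<odot> (Lam_prod a \<otimes> g \<otimes> LamT_prod a) = g \<otimes> Q_rhs a"
    by (rule sym)
qed

text \<open>Defining \<open>D\<close> by the conjugation formula makes \<open>D a (k + i)\<close> a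
  scalar multiple of the conjugate of \<open>D a i\<close>. Conjugation is an automorphism, so every
  relation has to be checked only at \<open>k = 0\<close>.\<close>

lemma linear_imp_generates_Q_solution:
  assumes g: "g \<in> Units R"
    and lin: "\<And>a. a \<in> {1..N} \<Longrightarrow> g \<otimes> Lam_prod a = (s ^ a) \<odot> (LamT_prod a \<otimes> g)"
      "\<And>a. a \<in> {1..N} \<Longrightarrow> (s ^ (3 * a)) \<odot> (Lam_prod a \<otimes> g \<otimes> LamT_prod a) = g \<otimes> Q_rhs a"
  shows "generates_Q_solution N (s\<^sup>2) s g"
proof -
  note [simp] = g_closed[OF g] Units_l_inv[OF g] Units_r_inv[OF g] conj_pow_closed[OF g]
    conj_pow_one[OF g] conj_pow_zero[OF g] conj_pow_0[OF g]
    conj_pow_smult[OF g]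
  \<comment> \<open>The value zero above \<open>N\<close> supplies the upper boundary condition;
    index 0 gives 1 by the general formula.\<close>
  define D where "D a k = (if a \<le> N then (s powi (- (int a * k))) \<odot> conj_pow g k (Lam_prod a) else \<zero>)"
    for a and k :: int
  have D_closed [simp]: "D a k \<in> carrier R" for a k
    by (simp add: D_def)
  have D_shift: "D a (k + i) = (s powi (- (int a * k))) \<odot> conj_pow g k (D a i)" for a k i
  proof (cases "a \<le> N")
    case True
    have "s powi (- (int a * (k + i))) = s powi (- (int a * k)) * s powi (- (int a * i))"
      using s_nonzero by (simp add: power_int_add[symmetric] algebra_simps)
    then show ?thesis
      using True by (simp add: D_def conj_pow_add[OF g])
  qed (simp add: D_def)
  have D0: "D a 0 = Lam_prod a" if "a \<le> N" for a
    using that by (simp add: D_def)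
  have D1: "D a 1 = LamT_prod a" if "a \<in> {1..N}" for a
  proof -
    have "g \<otimes> Lam_prod a \<otimes> inv g = (s ^ a) \<odot> (LamT_prod a \<otimes> (g \<otimes> inv g))"
      using that unfolding lin(1)[OF that] by (simp add: m_assoc del: Units_r_inv)
    then show ?thesis
      using that s_nonzero g by (simp add: D_def conj_pow_def power_int_minus)
  qed
  have comm1: "D b 1 \<otimes> D a 0 = (s\<^sup>2 powi int (min a b)) \<odot> (D a 0 \<otimes> D b 1)"
    if "a \<in> {1..N}" "b \<in> {1..N}" for a b
    using that LamT_prod_commute[of a b] by (simp add: D0 D1)
  have comm: "D b i \<otimes> D a 0 = (s\<^sup>2 powi (i * int (min a b))) \<odot> (D a 0 \<otimes> D b i)"
    if "a \<in> {1..N}" "b \<in> {1..N}" "\<bar>i\<bar> \<le> 1" for a b i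
  proof -
    consider "i = 0" | "i = 1" | "i = - 1" using \<open>\<bar>i\<bar> \<le> 1\<close> by linarith
    then show ?thesis
    proof cases
      case 1
      then show ?thesis using that by (simp add: D0 Lam_prod_mult add.commute)
    next
      case 2
      then show ?thesis using comm1[OF that(1,2)] by simp
    next
      case 3
      \<comment> \<open>The case \<open>i = - 1\<close> is the case \<open>i = 1\<close> with
        \<open>a\<close> and \<open>b\<close> exchanged, conjugated by the inverse of
        \<open>g\<close>. Reversing the order of the factors inverts the scalar.\<close>
      let ?c = "s\<^sup>2 powi int (min a b)"
      have c: "?c \<noteq> 0" using s_nonzero by simp
      have Db: "D b (- 1) = (s powi int b) \<odot> conj_pow g (- 1) (D b 0)"
        using D_shift[of b "- 1" 0] by simp
      have Da: "D a 0 = (s powi int a) \<odot> conj_pow g (- 1) (D a 1)"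
        using D_shift[of a "- 1" 1] by simp
      have "conj_pow g (- 1) (D a 1 \<otimes> D b 0) = ?c \<odot> conj_pow g (- 1) (D b 0 \<otimes> D a 1)"
        using comm1[OF that(2,1)] by (simp add: min.commute)
      then have "conj_pow g (- 1) (D a 1) \<otimes> conj_pow g (- 1) (D b 0)
          = ?c \<odot> (conj_pow g (- 1) (D b 0) \<otimes> conj_pow g (- 1) (D a 1))"
        by (simp add: conj_pow_mult[OF g])
      then show ?thesis
        using c 3 by (simp add: Da Db power_int_minus mult_ac)
    qed
  qed
  have Q0: "((s\<^sup>2) ^ a) \<odot> (D a (- 1) \<otimes> D a 1) = D a 0 \<otimes> D a 0 \<ominus> D (a + 1) 0 \<otimes> D (a - 1) 0"
    if a: "a \<in> {1..N}" for a
  proof -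
    have aN: "a \<le> N" using a by simp
    have "D a (- 1) = (s ^ a) \<odot> (inv g \<otimes> Lam_prod a \<otimes> g)"
      using a g by (simp add: D_def conj_pow_def)
    then have "((s\<^sup>2) ^ a) \<odot> (D a (- 1) \<otimes> D a 1)
        = inv g \<otimes> ((s ^ (3 * a)) \<odot> (Lam_prod a \<otimes> g \<otimes> LamT_prod a))"
      using a by (simp add: D1 m_assoc power_mult[symmetric] power_add[symmetric] mult.commute)
    also have "\<dots> = (inv g \<otimes> g) \<otimes> Q_rhs a"
      unfolding lin(2)[OF a] using aN by (simp only: m_assoc g_closed[OF g] Q_rhs_closed)
    also have "\<dots> = D a 0 \<otimes> D a 0 \<ominus> D (a + 1) 0 \<otimes> D (a - 1) 0"
      using a by (auto simp: Q_rhs_def D_def)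
    finally show ?thesis .
  qed
  have "opposite_quantum_Q_system R N (s\<^sup>2) D"
    unfolding opposite_quantum_Q_system_def
  proof (intro conjI ballI allI impI)
    show "D 0 k = \<one>" "D (N + 1) k = \<zero>" for k
      by (simp_all add: D_def)
  next
    fix k a b and i :: int
    assume ab: "a \<in> {1..N}" "b \<in> {1..N}" and i: "\<bar>i\<bar> \<le> 1"
    have "conj_pow g k (D b i) \<otimes> conj_pow g k (D a 0)
        = (s\<^sup>2 powi (i * int (min a b))) \<odot> (conj_pow g k (D a 0) \<otimes> conj_pow g k (D b i))"
      using arg_cong[OF comm[OF ab i], of "conj_pow g k"] by (simp add: conj_pow_mult[OF g])
    then show "D b (k + i) \<otimes> D a k = (s\<^sup>2 powi (i * int (min a b))) \<odot> (D a k \<otimes> D b (k + i))"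
      using D_shift[of b k i] D_shift[of a k 0] by (simp add: mult_ac)
  next
    fix a k assume a: "a \<in> {1..N}"
    let ?c = "s powi (- (int a * k))"
    have "((s\<^sup>2) ^ a) \<odot> (D a (k - 1) \<otimes> D a (k + 1))
        = (?c * ?c) \<odot> conj_pow g k (((s\<^sup>2) ^ a) \<odot> (D a (- 1) \<otimes> D a 1))"
      using D_shift[of a k "- 1"] D_shift[of a k 1] by (simp add: conj_pow_mult[OF g] mult_ac)
    also have "\<dots> = (?c * ?c) \<odot> (conj_pow g k (D a 0) \<otimes> conj_pow g k (D a 0)
        \<ominus> conj_pow g k (D (a + 1) 0) \<otimes> conj_pow g k (D (a - 1) 0))"
      unfolding Q0[OF a] by (simp add: conj_pow_diff[OF g] conj_pow_mult[OF g])
    also have "\<dots> = D a k \<otimes> D a k \<ominus> D (a + 1) k \<otimes> D (a - 1) k"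
    proof -
      \<comment> \<open>Since \<open>(a - 1) + (a + 1) = 2 * a\<close>, both terms on the right-hand
        side carry the same scalar.\<close>
      have "s powi (- (int (a - 1) * k)) * s powi (- (int (a + 1) * k)) = ?c * ?c"
        using a s_nonzero by (simp add: power_int_add[symmetric] of_nat_diff algebra_simps)
      moreover have "(?c * ?c) \<odot> (x \<ominus> y) = (?c * ?c) \<odot> x \<ominus> (?c * ?c) \<odot> y"
        if "x \<in> carrier R" "y \<in> carrier R" for x y
        using that by (simp add: minus_eq) (simp add: smult_eq algebra_simps)
      ultimately show ?thesis
        using D_shift[of a k 0] D_shift[of "a + 1" k 0] D_shift[of "a - 1" k 0] by simp
    qed
    finally show "((s\<^sup>2) ^ a) \<odot> (D a (k - 1) \<otimes> D a (k + 1))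
        = D a k [^] (2::nat) \<ominus> D (a + 1) k \<otimes> D (a - 1) k"
      by (simp add: numeral_2_eq_2)
  qed (auto simp: D_def)
  moreover have "\<forall>a\<in>{1..N}. \<forall>k::int. D a k = (s powi (- (int a * k))) \<odot> (g [^] k \<otimes> D a 0 \<otimes> g [^] (- k))"
    using D0 by (auto simp: D_def conj_pow_def)
  moreover have "\<forall>a\<in>{1..N}. D a 0 = ordered_prod R Lam a"
    by (auto simp: D0 ordered_prod_Lam)
  moreover have "\<forall>a\<in>{1..N}. D a 1 = ordered_prod R Lam a \<otimes> ordered_prod R Tgen a"
    by (auto simp: D1 ordered_prod_LamT)
  ultimately show ?thesis
    using g unfolding generates_Q_solution_def R_def by blast
qed

end

section \<open>Coefficients of the linear equations\<close>

definition sqnorm :: "nat \<Rightarrow> zvec \<Rightarrow> int" where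
  "sqnorm N m = (\<Sum>i\<in>{1..N}. (m i)\<^sup>2)"

text \<open>The exponent vector of \<open>x_a = Lambda_{a+1} / Lambda_a\<close>.\<close>

definition ratio_vec :: "nat \<Rightarrow> zvec" where
  "ratio_vec a = (\<lambda>i. eps (a + 1) i - eps a i)"

lemma ratio_vec_zvecs [simp]: "a \<in> {1..<N} \<Longrightarrow> ratio_vec a \<in> zvecs N"
  unfolding ratio_vec_def by (auto simp: zvecs_def eps_def)

lemma psum_ratio_vec:
  assumes "a \<ge> 1"
  shows "psum (ratio_vec a) b = (if b = a then - 1 else 0)"
  by (induction b) (use assms in \<open>auto simp: ratio_vec_def eps_def\<close>)

lemma power_int_eq_1_imp:
  fixes s :: complex
  assumes "norm s < 1" "s \<noteq> 0" "s powi k = 1"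
  shows "k = 0"
proof (cases "k \<ge> 0")
  case True
  then show ?thesis using assms power_eq_1_iff[of s "nat k"] by (auto simp: power_int_def)
next
  case False
  then show ?thesis
    using assms power_eq_1_iff[of s "nat (- k)"] by (auto simp: power_int_def field_simps)
qed

context qtorus_ring
begin

lemma sqnorm_diff:
  "sqnorm N (\<lambda>i. m i - w i) = sqnorm N m - (\<Sum>i\<in>{1..N}. 2 * (m i - w i) * w i + (w i)\<^sup>2)"
  unfolding sqnorm_def sum_subtractf[symmetric]
  by (rule sum.cong) (simp_all add: power2_eq_square algebra_simps)

text \<open>\<open>gauss_series f\<close> is \<open>G\<^sub>1 \<cdots> G\<^sub>N f(\<Lambda>)\<close>, where \<open>f m\<close> is the coefficient of \<open>\<Lambda>\<^sup>m\<close>: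
  moving the Gaussians to the right turns \<open>\<Lambda>\<^sup>m\<close> into \<open>s\<^bsup>sqnorm m\<^esup> \<Lambda>\<^sup>m T\<^sup>m\<close>.\<close>
definition gauss_series :: "(zvec \<Rightarrow> complex) \<Rightarrow> gmono \<Rightarrow> complex" where
  "gauss_series f = (\<lambda>(m, n, l).
     if n = m \<and> l = eps_upto N then s powi sqnorm N m * f m else 0)"

lemma gauss_series_eq_iff: "gauss_series f = gauss_series f' \<longleftrightarrow> f = f'"
proof
  assume eq: "gauss_series f = gauss_series f'"
  show "f = f'"
  proof
    fix m show "f m = f' m"
      using fun_cong[OF eq, of "(m, m, eps_upto N)"] s_nonzero by (simp add: gauss_series_def)
  qed
qed simp

lemma gauss_series_smult: "c \<odot> gauss_series f = gauss_series (\<lambda>m. c * f m)"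
  by (auto simp: gauss_series_def smult_eq)

text \<open>The Gaussians stand on the left of \<open>f\<close>, so right multiplication by
  \<open>Lambda^w\<close> only shifts \<open>f\<close>. The twist of the normally ordered form
  equals the change in \<open>sqnorm\<close>.\<close>

lemma gauss_series_mult_Lam:
  assumes "w \<in> zvecs N"
  shows "gauss_series f \<otimes> qmono (w, \<lambda>i. 0, \<lambda>i. 0) = gauss_series (\<lambda>m. f (\<lambda>i. m i - w i))"
proof (rule ext, clarify)
  fix m n l
  have uw: "eps_upto N i * w i = w i" for i
    using assms by (auto simp: eps_upto_def zvecs_def)
  show "(gauss_series f \<otimes> qmono (w, \<lambda>i. 0, \<lambda>i. 0)) (m, n, l)
      = gauss_series (\<lambda>m. f (\<lambda>i. m i - w i)) (m, n, l)"
  proof (cases "l = eps_upto N")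
    case l: True
    show ?thesis
    proof (cases "n = m")
      case True
      have "(\<Sum>i\<in>{1..N}. 2 * (m i - w i) * w i + l i * (w i)\<^sup>2)
          = (\<Sum>i\<in>{1..N}. 2 * (m i - w i) * w i + (w i)\<^sup>2)"
        by (rule sum.cong) (simp_all add: l eps_upto_def)
      then show ?thesis
        using True l s_nonzero
        by (simp add: qmono_mult_right gauss_series_def uw sqnorm_diff power_int_diff)
    next
      case False
      then have "(\<lambda>i. n i - w i) \<noteq> (\<lambda>i. m i - w i)" by (auto simp: fun_eq_iff)
      then show ?thesis using False l by (simp add: qmono_mult_right gauss_series_def uw)
    qed
  qed (simp add: qmono_mult_right gauss_series_def)
qed

text \<open>Each Gaussian \<open>G_i\<close> with \<open>i\<close> at most \<open>a\<close>
  conjugates \<open>Lambda_i\<close> to \<open>s Lambda_i T_i\<close>. Read backwards,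
  \<open>LamT_prod a\<close> passes the Gaussians and becomes \<open>Lam_prod a\<close> at the cost
  of \<open>s\<close> to the power \<open>-a\<close>.\<close>

lemma LamT_prod_gauss_series:
  assumes "a \<le> N"
  shows "LamT_prod a \<otimes> gauss_series f
    = (s powi (- int a)) \<odot> gauss_series (\<lambda>m. f (\<lambda>i. m i - eps_upto a i))"
proof (rule ext, clarify)
  fix m n l
  have "(\<Sum>i\<in>{1..N}. 2 * eps_upto a i * (m i - eps_upto a i))
      = (\<Sum>i\<in>{1..N}. 2 * (m i - eps_upto a i) * eps_upto a i)"
    by (rule sum.cong) (simp_all add: algebra_simps)
  also have "\<dots> = 2 * psum m a - 2 * int a"
    by (subst sum_eps_upto[OF assms]) (simp add: psum_mult psum_eps_upto)
  finally have "(\<Sum>i\<in>{1..N}. 2 * eps_upto a i * (m i - eps_upto a i)) = 2 * psum m a - 2 * int a" .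
  moreover have "sqnorm N (\<lambda>i. m i - eps_upto a i) = sqnorm N m - (2 * psum m a - int a)"
    using sum_eps_upto[OF assms, of "\<lambda>i. 2 * (m i - eps_upto a i) + 1"]
    by (simp add: sqnorm_diff psum_mult psum_eps_upto ring_distribs)
  moreover have "(\<lambda>i. n i - eps_upto a i) = (\<lambda>i. m i - eps_upto a i) \<longleftrightarrow> n = m"
    by (auto simp: fun_eq_iff)
  ultimately show "(LamT_prod a \<otimes> gauss_series f) (m, n, l)
      = ((s powi (- int a)) \<odot> gauss_series (\<lambda>m. f (\<lambda>i. m i - eps_upto a i))) (m, n, l)"
    unfolding LamT_prod_def qmono_mult_left gauss_series_def smult_eq
    using s_nonzero by (simp add: power_int_add[symmetric] mult.assoc[symmetric])
qed

text \<open>Moving \<open>Lam_prod a\<close> to the right past the Gaussians creates inverses of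
  \<open>T_1, ..., T_a\<close>. These rescale the coefficients as they pass the Lambdas and then
  cancel against the \<open>T_i\<close> of \<open>LamT_prod a\<close>, so a series of the same shape
  remains.\<close>

lemma Lam_gauss_series_LamT:
  assumes "a \<le> N"
  shows "Lam_prod a \<otimes> gauss_series f \<otimes> LamT_prod a
    = gauss_series (\<lambda>m. s powi (int a - 2 * psum m a) * f (\<lambda>i. m i - 2 * eps_upto a i))"
proof (rule ext, clarify)
  fix m n l
  let ?e = "eps_upto a"
  let ?lhs = "(Lam_prod a \<otimes> gauss_series f \<otimes> LamT_prod a) (m, n, l)"
  have e2: "(\<lambda>i. m i - ?e i - ?e i) = (\<lambda>i. m i - 2 * ?e i)" for m by auto
  have lhs: "?lhs = s powi (\<Sum>i\<in>{1..N}. 2 * (n i - ?e i - l i * ?e i) * ?e i + l i * ?e i)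
      * gauss_series f (\<lambda>i. m i - 2 * ?e i, \<lambda>i. n i - ?e i - l i * ?e i, l)"
    unfolding Lam_prod_def LamT_prod_def
    by (simp add: qmono_mult_left qmono_mult_right e2)
  show "?lhs = gauss_series (\<lambda>m. s powi (int a - 2 * psum m a) * f (\<lambda>i. m i - 2 * ?e i)) (m, n, l)"
  proof (cases "l = eps_upto N")
    case l: True
    have ue: "eps_upto N i * ?e i = ?e i" for i
      using assms by (auto simp: eps_upto_def)
    show ?thesis
    proof (cases "n = m")
      case True
      have "(\<Sum>i\<in>{1..N}. 2 * (n i - ?e i - l i * ?e i) * ?e i + l i * ?e i)
          = (\<Sum>i\<in>{1..N}. (2 * m i - 4 * ?e i + 1) * ?e i)"
        by (rule sum.cong) (simp_all add: l ue True ring_distribs)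
      also have "\<dots> = 2 * psum m a - 3 * int a"
        by (subst sum_eps_upto[OF assms]) (simp add: psum_mult psum_eps_upto psum_const)
      finally have 1: "(\<Sum>i\<in>{1..N}. 2 * (n i - ?e i - l i * ?e i) * ?e i + l i * ?e i)
          = 2 * psum m a - 3 * int a" .
      have 2: "sqnorm N (\<lambda>i. m i - 2 * ?e i) = sqnorm N m - (4 * psum m a - 4 * int a)"
      proof -
        have "(\<Sum>i\<in>{1..N}. 2 * (m i - 2 * ?e i) * (2 * ?e i) + (2 * ?e i)\<^sup>2)
            = (\<Sum>i\<in>{1..N}. (4 * m i - 8 * ?e i + 4) * ?e i)"
          by (rule sum.cong) (simp_all add: ring_distribs power_mult_distrib)
        also have "\<dots> = 4 * psum m a - 4 * int a"
          by (subst sum_eps_upto[OF assms]) (simp add: psum_mult psum_eps_upto psum_const)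
        finally show ?thesis by (simp only: sqnorm_diff)
      qed
      show ?thesis
        unfolding lhs 1 using s_nonzero
        by (simp add: gauss_series_def l ue True 2 power_int_add[symmetric] mult.assoc[symmetric]
            add_diff_eq add.commute)
    next
      case False
      then have "(\<lambda>i. n i - ?e i - ?e i) \<noteq> (\<lambda>i. m i - 2 * ?e i)" by (auto simp: fun_eq_iff)
      then show ?thesis using False l unfolding lhs by (simp add: gauss_series_def ue)
    qed
  qed (simp add: lhs, simp add: gauss_series_def)
qed

lemma gauss_series_Lam_prod:
  assumes "a \<le> N"
  shows "gauss_series f \<otimes> Lam_prod a = (s ^ a) \<odot> (LamT_prod a \<otimes> gauss_series f)"
  using assms s_nonzero
  by (simp add: LamT_prod_gauss_series) (simp add: Lam_prod_def gauss_series_mult_Lam power_int_minus)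

lemma gauss_series_Q_rhs:
  assumes "gauss_series f \<in> carrier R" "a \<in> {1..N}"
  shows "gauss_series f \<otimes> Q_rhs a = gauss_series (\<lambda>m. f (\<lambda>i. m i - 2 * eps_upto a i)
    - (if a = N then 0 else f (\<lambda>i. m i - 2 * eps_upto a i - ratio_vec a i)))"
proof -
  let ?e = "eps_upto a"
  have LL: "gauss_series f \<otimes> (Lam_prod a \<otimes> Lam_prod a) = gauss_series (\<lambda>m. f (\<lambda>i. m i - 2 * ?e i))"
    unfolding Lam_prod_mult using assms by (subst gauss_series_mult_Lam) simp_all
  have closed: "gauss_series f \<otimes> x \<in> carrier R" if "x \<in> carrier R" for x
    using assms that by simp
  have "gauss_series f \<otimes> Q_rhs a = gauss_series f \<otimes> (Lam_prod a \<otimes> Lam_prod a)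
      \<ominus> gauss_series f \<otimes> (if a = N then \<zero> else Lam_prod (a + 1) \<otimes> Lam_prod (a - 1))"
    using assms by (auto simp: Q_rhs_def a_minus_def r_distr r_minus)
  also have "\<dots> = gauss_series (\<lambda>m. f (\<lambda>i. m i - 2 * ?e i)
    - (if a = N then 0 else f (\<lambda>i. m i - 2 * ?e i - ratio_vec a i)))"
  proof (cases "a = N")
    case True
    have "gauss_series f \<otimes> (Lam_prod a \<otimes> Lam_prod a) \<in> carrier R"
      using assms by simp
    then show ?thesis
      using assms LL by (simp add: True a_minus_def) (simp add: add_eq zero_eq)
  next
    case False
    \<comment> \<open>In monomials: \<open>L_{a+1} L_{a-1} = L_a^2 x_a\<close>, which is how the
      ratio variables enter.\<close>
    have e: "eps_upto (a + 1) i + eps_upto (a - 1) i = 2 * ?e i + ratio_vec a i" for i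
      using assms by (auto simp: eps_upto_def ratio_vec_def eps_def)
    have "gauss_series f \<otimes> (Lam_prod (a + 1) \<otimes> Lam_prod (a - 1))
        = gauss_series (\<lambda>m. f (\<lambda>i. m i - 2 * ?e i - ratio_vec a i))"
      unfolding Lam_prod_mult e using assms False
      by (subst gauss_series_mult_Lam) (simp_all add: diff_diff_eq)
    moreover have "gauss_series f \<otimes> (Lam_prod (a + 1) \<otimes> Lam_prod (a - 1)) \<in> carrier R"
      "gauss_series f \<otimes> (Lam_prod a \<otimes> Lam_prod a) \<in> carrier R"
      using assms False by (auto intro!: m_closed Lam_prod_closed)
    ultimately show ?thesis
      using False LL by (simp add: minus_eq) (auto simp: gauss_series_def right_diff_distrib)
  qed
  finally show ?thesis .
qed

text \<open>Coefficient comparison turns the quadratic relation into a first-order recursion in the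
  direction of \<open>x_a\<close>. For \<open>a = N\<close> it says that \<open>f\<close> vanishes
  wherever \<open>1 - s powi (- 2 * psum m N)\<close> does not.\<close>

lemma gauss_series_Q_relation_iff:
  assumes "gauss_series f \<in> carrier R" "a \<in> {1..N}"
  shows "(s ^ (3 * a)) \<odot> (Lam_prod a \<otimes> gauss_series f \<otimes> LamT_prod a) = gauss_series f \<otimes> Q_rhs a
    \<longleftrightarrow> (\<forall>m. (1 - s powi (- 2 * psum m a)) * f m
            = (if a = N then 0 else f (\<lambda>i. m i - ratio_vec a i)))"
proof -
  let ?e = "eps_upto a"
  have aN: "a \<le> N" using assms by simp
  have lhs: "(s ^ (3 * a)) \<odot> (Lam_prod a \<otimes> gauss_series f \<otimes> LamT_prod a)
      = gauss_series (\<lambda>m. s powi (4 * int a - 2 * psum m a) * f (\<lambda>i. m i - 2 * ?e i))"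
  proof -
    have "s ^ (3 * a) * s powi (int a - 2 * psum m a) = s powi (4 * int a - 2 * psum m a)" for m
      using s_nonzero power_int_add[of s "int (3 * a)" "int a - 2 * psum m a"]
      unfolding power_int_of_nat by simp
    then show ?thesis
      by (simp add: Lam_gauss_series_LamT[OF aN] gauss_series_smult mult.assoc[symmetric])
  qed
  have "?thesis \<longleftrightarrow> ((\<forall>m. s powi (4 * int a - 2 * psum m a) * f (\<lambda>i. m i - 2 * ?e i)
      = f (\<lambda>i. m i - 2 * ?e i) - (if a = N then 0 else f (\<lambda>i. m i - 2 * ?e i - ratio_vec a i)))
      \<longleftrightarrow> (\<forall>m. (1 - s powi (- 2 * psum m a)) * f m
            = (if a = N then 0 else f (\<lambda>i. m i - ratio_vec a i))))" (is "_ \<longleftrightarrow> (All ?P \<longleftrightarrow> All ?Q)")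
    unfolding lhs gauss_series_Q_rhs[OF assms] gauss_series_eq_iff by (simp only: fun_eq_iff)
  \<comment> \<open>Translating \<open>m\<close> by twice \<open>eps_upto a\<close> raises
    \<open>psum m a\<close> by \<open>2 * a\<close>, which absorbs the \<open>4 * a\<close> in the
    exponent of \<open>s\<close>.\<close>
  moreover have PQ: "?P (\<lambda>i. m i + 2 * ?e i) \<longleftrightarrow> ?Q m" for m
    by (auto simp: psum_mult psum_eps_upto algebra_simps)
  moreover have "?P m" if "\<forall>m. ?P (\<lambda>i. m i + 2 * ?e i)" for m
    using that[rule_format, of "\<lambda>i. m i - 2 * ?e i"] by (simp only: diff_add_cancel)
  ultimately show ?thesis by blast
qed

text \<open>The equation ties the coefficient at \<open>(m, n, l)\<close> to the one at the same
  \<open>m\<close> and \<open>l\<close> with \<open>n\<close> shifted by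
  \<open>(l - 1) * eps_upto a\<close>. A nonzero shift could be iterated forever, against finiteness
  over fixed \<open>m\<close>; a zero shift leaves an equality of powers of \<open>s\<close> that
  determines \<open>n\<close>.\<close>

lemma linear_imp_gauss_series:
  assumes x: "x \<in> carrier R" and s: "norm s < 1"
    and lin: "\<And>a. a \<in> {1..N} \<Longrightarrow> x \<otimes> Lam_prod a = (s ^ a) \<odot> (LamT_prod a \<otimes> x)"
  shows "\<exists>f. x = gauss_series f"
proof -
  have lin': "s powi (2 * psum n a + psum l a) * x (m, n, l)
      = s ^ a * s powi (2 * psum m a) * x (m, \<lambda>i. n i + (l i - 1) * eps_upto a i, l)"
    if a: "a \<in> {1..N}" for a m n l
  proof -
    have aN: "a \<le> N" using a by simp
    let ?e = "eps_upto a"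
    have "(\<Sum>i\<in>{1..N}. 2 * n i * ?e i + l i * ?e i) = 2 * psum n a + psum l a"
      using sum_eps_upto[OF aN, of "\<lambda>i. 2 * n i + l i"] by (simp add: ring_distribs psum_mult)
    moreover have "(\<Sum>i\<in>{1..N}. 2 * ?e i * m i) = 2 * psum m a"
      using sum_eps_upto[OF aN, of "\<lambda>i. 2 * m i"] by (simp add: psum_mult mult.assoc mult.commute[of "?e _"])
    ultimately show ?thesis
      \<comment> \<open>This index is chosen so that the coefficient of \<open>x\<close> on the
        left-hand side is the one at \<open>(m, n, l)\<close>.\<close>
      using fun_cong[OF lin[OF a], of "(\<lambda>i. m i + ?e i, \<lambda>i. n i + l i * ?e i, l)"]
      unfolding Lam_prod_def LamT_prod_def qmono_mult_left qmono_mult_right smult_eq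
      by (simp add: algebra_simps)
  qed
  have supp: "n = m \<and> l = eps_upto N" if nz: "x (m, n, l) \<noteq> 0" for m n l
  proof -
    have zv: "m \<in> zvecs N" "n \<in> zvecs N" "l \<in> zvecs N"
      using x nz by (auto simp: carrier_iff admissible_def)
    have l1: "l a = 1" if a: "a \<in> {1..N}" for a
    proof (rule ccontr)
      assume la: "l a \<noteq> 1"
      \<comment> \<open>The orbit of \<open>n\<close> under the shift. Its \<open>a\<close>-th entry
        is \<open>n a + t * (l a - 1)\<close>, so the orbit is infinite when \<open>l a\<close>
        differs from 1.\<close>
      define h where "h t = (\<lambda>i. n i + int t * ((l i - 1) * eps_upto a i))" for t
      have "x (m, h t, l) \<noteq> 0" for t
      proof (induction t)
        case (Suc t)
        have "(\<lambda>i. h t i + (l i - 1) * eps_upto a i) = h (Suc t)"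
          by (auto simp: h_def algebra_simps)
        then show ?case
          using lin'[OF a, of "h t" l m] Suc s_nonzero by auto
      qed (use nz in \<open>simp add: h_def\<close>)
      then have "range (\<lambda>t. (h t, l)) \<subseteq> {(n, l). x (m, n, l) \<noteq> 0}" by auto
      moreover have "finite {(n, l). x (m, n, l) \<noteq> 0}"
        using x by (simp add: carrier_iff admissible_def)
      ultimately have "finite (range (\<lambda>t. (h t, l)))" by (rule finite_subset)
      moreover have "inj (\<lambda>t. (h t, l))"
      proof (rule injI)
        fix t t' assume "(h t, l) = (h t', l)"
        then have "h t a = h t' a" by simp
        then show "t = t'" using a la by (simp add: h_def eps_upto_def)
      qed
      ultimately show False using finite_imageD infinite_UNIV_nat by blast
    qed
    then have l: "l = eps_upto N"
      using zv by (auto simp: eps_upto_def zvecs_def fun_eq_iff)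
    have "psum n a = psum m a" if a: "a \<in> {1..N}" for a
    proof -
      have aN: "a \<le> N" using a by simp
      \<comment> \<open>Now the shift is trivial and both sides contain the same nonzero
        coefficient, so the powers of \<open>s\<close> agree; \<open>s\<close> is not a root of
        unity.\<close>
      have e: "(\<lambda>i. n i + (l i - 1) * eps_upto a i) = n"
        using aN by (auto simp: l eps_upto_def)
      have "s powi (2 * psum n a + int a) = s powi (int a + 2 * psum m a)"
        using lin'[OF a, of n l m] nz s_nonzero aN unfolding e
        by (simp add: l psum_eps_upto min.absorb2 power_int_add)
      then have "s powi (2 * psum n a - 2 * psum m a) = 1"
        using s_nonzero by (simp add: power_int_add power_int_diff)
      then show ?thesis using power_int_eq_1_imp[OF s s_nonzero] by force
    qed
    then show ?thesis using zvec_eqI[OF zv(2,1)] l by blast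
  qed
  define f where "f m = x (m, m, eps_upto N) / s powi sqnorm N m" for m
  have "x = gauss_series f"
  proof (rule ext, clarify)
    fix m n l show "x (m, n, l) = gauss_series f (m, n, l)"
      using supp[of m n l] s_nonzero by (auto simp: gauss_series_def f_def)
  qed
  then show ?thesis by blast
qed

end

section \<open>Quantum dilogarithms\<close>

lemma ratio_cone_eq_0:
  assumes "m \<in> ratio_cone N" "\<And>a. a \<in> {1..<N} \<Longrightarrow> psum m a = 0"
  shows "m = (\<lambda>i. 0)"
proof -
  have m: "m \<in> zvecs N" "psum m N = 0" using assms(1) by (auto simp: ratio_cone_iff)
  have "psum m a = psum (\<lambda>i. 0) a" if "a \<in> {1..N}" for a
  proof (cases "a = N")
    case False
    then show ?thesis using that assms(2)[of a] by simp
  qed (simp add: m)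
  then show ?thesis using m by (intro zvec_eqI[of _ N]) simp_all
qed

text \<open>Euler's expansion of \<open>1 / (x; q)_infinity\<close>. The value 0 at negative indices
  lets the recursion below hold for all integers.\<close>

definition dilog_coeff :: "complex \<Rightarrow> int \<Rightarrow> complex" where
  "dilog_coeff q k = (if k < 0 then 0 else 1 / (\<Prod>j\<in>{1..nat k}. 1 - q ^ j))"

text \<open>Euler's expansion of \<open>(x; q)_infinity\<close>, again extended by 0.\<close>

definition dilog_inv_coeff :: "complex \<Rightarrow> int \<Rightarrow> complex" where
  "dilog_inv_coeff q k = (if k < 0 then 0
     else (- 1) ^ nat k * q ^ (nat k choose 2) / (\<Prod>j\<in>{1..nat k}. 1 - q ^ j))"

lemma one_minus_power_nonzero:
  fixes q :: complex
  assumes "norm q < 1" "j > 0"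
  shows "1 - q ^ j \<noteq> 0"
  using assms power_eq_1_iff[of q j] by auto

text \<open>The coefficient form of \<open>phi(q x) = (1 - x) phi(x)\<close>. At
  \<open>k = 0\<close> both sides vanish.\<close>

lemma dilog_coeff_rec:
  assumes "norm q < 1"
  shows "(1 - q powi k) * dilog_coeff q k = dilog_coeff q (k - 1)"
proof (cases "k > 0")
  case True
  define n where "n = nat (k - 1)"
  have k: "k = int (Suc n)" using True by (simp add: n_def)
  show ?thesis
    using one_minus_power_nonzero[OF assms, of "Suc n"]
    unfolding k power_int_of_nat by (simp add: dilog_coeff_def nat_add_distrib)
qed (auto simp: dilog_coeff_def)

text \<open>The coefficient form of the dual equation
  \<open>psi(x) = (1 - x) psi(q x)\<close>.\<close>

lemma dilog_inv_coeff_rec: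
  assumes "norm q < 1"
  shows "(1 - q powi k) * dilog_inv_coeff q k = - (q powi (k - 1)) * dilog_inv_coeff q (k - 1)"
proof (cases "k > 0")
  case True
  define n where "n = nat (k - 1)"
  have k: "k = int (Suc n)" using True by (simp add: n_def)
  have "Suc n choose 2 = n + (n choose 2)" by (simp add: numeral_2_eq_2)
  moreover have "nat (int (Suc n)) = Suc n" "int (Suc n) - 1 = int n" by simp_all
  ultimately show ?thesis
    using one_minus_power_nonzero[OF assms, of "Suc n"]
    unfolding k power_int_of_nat
    by (simp only: power_int_of_nat dilog_inv_coeff_def) (simp add: power_add)
qed (auto simp: dilog_inv_coeff_def)

text \<open>The coefficients of \<open>\<Prod>\<^bsub>a<N\<^esub> \<Sum>\<^bsub>k\<^esub> \<phi> k (\<Lambda>\<^bsub>a+1\<^esub> / \<Lambda>\<^sub>a)\<^sup>k\<close>: the exponent of \<open>\<Lambda>\<^bsub>a+1\<^esub> / \<Lambda>\<^sub>a\<close>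
  in \<open>\<Lambda>\<^sup>m\<close> is \<open>- psum m a\<close>.\<close>
definition ratio_series :: "nat \<Rightarrow> (int \<Rightarrow> complex) \<Rightarrow> zvec \<Rightarrow> complex" where
  "ratio_series N \<phi> m =
     (if m \<in> zvecs N \<and> psum m N = 0 then \<Prod>a\<in>{1..<N}. \<phi> (- psum m a) else 0)"

lemma ratio_series_cone:
  assumes "\<And>k. k < 0 \<Longrightarrow> \<phi> k = 0" "ratio_series N \<phi> m \<noteq> 0"
  shows "m \<in> ratio_cone N"
proof -
  have "psum m a \<le> 0" if "a \<in> {1..<N}" for a
  proof (rule ccontr)
    assume "\<not> psum m a \<le> 0"
    then have "\<phi> (- psum m a) = 0" by (intro assms(1)) simp
    then have "(\<Prod>a\<in>{1..<N}. \<phi> (- psum m a)) = 0" using that by (intro prod_zero) auto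
    then have "ratio_series N \<phi> m = 0"
      unfolding ratio_series_def by (simp only: if_cancel)
    then show False using assms(2) by contradiction
  qed
  then show ?thesis
    using assms(2) by (auto simp: ratio_cone_iff ratio_series_def split: if_splits)
qed

lemma ratio_series_0: "\<phi> 0 = 1 \<Longrightarrow> ratio_series N \<phi> (\<lambda>i. 0) = 1"
  by (simp add: ratio_series_def)

text \<open>Subtracting \<open>ratio_vec a\<close> lowers the exponent of \<open>x_a\<close> by one
  and fixes the other exponents, so only the factor at \<open>a\<close> changes. General
  \<open>A\<close> and \<open>B\<close> cover both dilogarithm recursions.\<close>

lemma ratio_series_rec:
  assumes rec: "\<And>k. A k * \<phi> k = B k * \<phi> (k - 1)" and a: "a \<in> {1..<N}"
  shows "A (- psum m a) * ratio_series N \<phi> m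
    = B (- psum m a) * ratio_series N \<phi> (\<lambda>i. m i - ratio_vec a i)"
proof -
  let ?m = "\<lambda>i. m i - ratio_vec a i"
  have psum_m: "psum ?m b = (if b = a then psum m a + 1 else psum m b)" for b
    using a by (simp add: psum_ratio_vec)
  have zv: "?m \<in> zvecs N \<longleftrightarrow> m \<in> zvecs N"
  proof
    assume "?m \<in> zvecs N"
    then have "(\<lambda>i. ?m i + ratio_vec a i) \<in> zvecs N" using a by (intro zvecs_simps(2)) simp_all
    then show "m \<in> zvecs N" by simp
  qed (use a in simp)
  have P: "(\<Prod>b\<in>{1..<N}. g b) = g a * (\<Prod>b\<in>{1..<N} - {a}. g b)" for g :: "nat \<Rightarrow> complex"
    using a by (simp add: prod.remove)
  have "A (- psum m a) * (\<Prod>b\<in>{1..<N}. \<phi> (- psum m b))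
      = B (- psum m a) * (\<Prod>b\<in>{1..<N}. \<phi> (- psum ?m b))"
    unfolding P using rec[of "- psum m a"]
    by (simp add: psum_m mult.assoc[symmetric] del: psum_diff)
  moreover have "psum ?m N = psum m N" using a by (simp add: psum_m del: psum_diff)
  ultimately show ?thesis
    unfolding ratio_series_def zv by simp
qed

context qtorus_ring
begin

text \<open>\<open>lam_series v f\<close> is \<open>f(\<Lambda>) T\<^sup>v\<close>.\<close>
definition lam_series :: "zvec \<Rightarrow> (zvec \<Rightarrow> complex) \<Rightarrow> gmono \<Rightarrow> complex" where
  "lam_series v f = (\<lambda>(m, n, l). if n = v \<and> l = (\<lambda>i. 0) then f m else 0)"

lemma lam_series_closed:
  assumes "v \<in> zvecs N" "\<And>m. f m \<noteq> 0 \<Longrightarrow> m \<in> ratio_cone N"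
  shows "lam_series v f \<in> carrier R"
proof -
  have "finite {(n, l). lam_series v f (m, n, l) \<noteq> 0}" for m
    by (rule finite_subset[of _ "{(v, \<lambda>i. 0)}"]) (auto simp: lam_series_def split: if_splits)
  moreover have "\<exists>F. finite F \<and> (\<forall>m n l. lam_series v f (m, n, l) \<noteq> 0 \<longrightarrow>
      (\<exists>m0\<in>F. (\<lambda>i. m i - m0 i) \<in> ratio_cone N))"
    by (rule exI[of _ "{\<lambda>i. 0}"]) (use assms in \<open>auto simp: lam_series_def split: if_splits\<close>)
  ultimately show ?thesis
    using assms by (auto simp: carrier_iff admissible_def lam_series_def ratio_cone_iff split: if_splits)
qed

lemma T_mult_lam_series:
  "qmono (\<lambda>i. 0, v, \<lambda>i. 0) \<otimes> lam_series w f
    = lam_series (\<lambda>i. v i + w i) (\<lambda>m. s powi (\<Sum>i\<in>{1..N}. 2 * v i * m i) * f m)"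
proof (rule ext, clarify)
  fix m n l
  have "(\<lambda>i. n i - v i) = w \<longleftrightarrow> n = (\<lambda>i. v i + w i)"
    by (auto simp: algebra_simps)
  then show "(qmono (\<lambda>i. 0, v, \<lambda>i. 0) \<otimes> lam_series w f) (m, n, l)
      = lam_series (\<lambda>i. v i + w i) (\<lambda>m. s powi (\<Sum>i\<in>{1..N}. 2 * v i * m i) * f m) (m, n, l)"
    by (simp add: qmono_mult_left lam_series_def)
qed

lemma lam_series_mult_T:
  "lam_series w f \<otimes> qmono (\<lambda>i. 0, v, \<lambda>i. 0) = lam_series (\<lambda>i. v i + w i) f"
proof (rule ext, clarify)
  fix m n l
  have "(\<lambda>i. n i - v i) = w \<longleftrightarrow> n = (\<lambda>i. v i + w i)"
    by (auto simp: algebra_simps)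
  then show "(lam_series w f \<otimes> qmono (\<lambda>i. 0, v, \<lambda>i. 0)) (m, n, l)
      = lam_series (\<lambda>i. v i + w i) f (m, n, l)"
    by (simp add: qmono_mult_right lam_series_def)
qed

lemma Lam_mult_lam_series:
  "qmono (w, \<lambda>i. 0, \<lambda>i. 0) \<otimes> lam_series v f = lam_series v (\<lambda>m. f (\<lambda>i. m i - w i))"
  by (rule ext) (auto simp: qmono_mult_left lam_series_def)

lemma lam_series_mult_Lam:
  "lam_series (\<lambda>i. 0) f \<otimes> qmono (w, \<lambda>i. 0, \<lambda>i. 0) = lam_series (\<lambda>i. 0) (\<lambda>m. f (\<lambda>i. m i - w i))"
proof (rule ext, clarify)
  fix m n l
  show "(lam_series (\<lambda>i. 0) f \<otimes> qmono (w, \<lambda>i. 0, \<lambda>i. 0)) (m, n, l)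
      = lam_series (\<lambda>i. 0) (\<lambda>m. f (\<lambda>i. m i - w i)) (m, n, l)"
    by (cases "l = (\<lambda>i. 0)") (simp_all add: qmono_mult_right lam_series_def)
qed

text \<open>Without \<open>T\<close> and \<open>G\<close> all twists are trivial. This turns the
  one-sided inverse of the dilogarithm product into a two-sided one.\<close>

lemma lam_series_mult_commute:
  assumes "lam_series (\<lambda>i. 0) f \<in> carrier R" "lam_series (\<lambda>i. 0) h \<in> carrier R"
  shows "lam_series (\<lambda>i. 0) f \<otimes> lam_series (\<lambda>i. 0) h = lam_series (\<lambda>i. 0) h \<otimes> lam_series (\<lambda>i. 0) f"
proof
  fix p
  let ?f = "lam_series (\<lambda>i. 0) f" and ?h = "lam_series (\<lambda>i. 0) h"
  let ?F = "{p. ?f p \<noteq> 0}" and ?H = "{p. ?h p \<noteq> 0}"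
  have comm: "mono_comp p1 p2 = mono_comp p2 p1" "mono_twist N p1 p2 = mono_twist N p2 p1"
    if "?f p1 \<noteq> 0" "?h p2 \<noteq> 0" for p1 p2
    using that by (cases p1; cases p2; auto simp: lam_series_def add.commute split: if_splits)+
  have "(?f \<otimes> ?h) p = (\<Sum>(p1, p2)\<in>comp_pairs ?F ?H p. s powi mono_twist N p1 p2 * ?f p1 * ?h p2)"
    using assms by (subst mult_eq[of ?F ?H]) (auto simp: carrier_iff)
  also have "\<dots> = (\<Sum>(p2, p1)\<in>comp_pairs ?H ?F p. s powi mono_twist N p2 p1 * ?h p2 * ?f p1)"
  proof (rule sum.reindex_bij_witness[where i = prod.swap and j = prod.swap])
    fix w assume "w \<in> comp_pairs ?F ?H p"
    then obtain p1 p2 where "w = (p1, p2)" "?f p1 \<noteq> 0" "?h p2 \<noteq> 0"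
      unfolding comp_pairs_def by blast
    then show "(\<lambda>(p2, p1). s powi mono_twist N p2 p1 * ?h p2 * ?f p1) (prod.swap w)
        = (\<lambda>(p1, p2). s powi mono_twist N p1 p2 * ?f p1 * ?h p2) w"
      using comm(2)[of p1 p2] by simp
  qed (use comm(1) in \<open>force simp: comp_pairs_def simp del: mono_comp.simps\<close>)+
  also have "\<dots> = (?h \<otimes> ?f) p"
    using assms by (subst mult_eq[of ?H ?F]) (auto simp: carrier_iff)
  finally show "(?f \<otimes> ?h) p = (?h \<otimes> ?f) p" .
qed

end

section \<open>The dilogarithm product and its inverse\<close>

locale qtorus_small = qtorus_ring +
  fixes q :: complex
  assumes norm_q: "norm q < 1" and s2: "s\<^sup>2 = q"
begin

lemmas generates_imp_linear = generates_Q_solution_imp_linear[unfolded s2]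
lemmas linear_imp_generates = linear_imp_generates_Q_solution[unfolded s2]

lemma q_nonzero: "q \<noteq> 0"
  using s2 s_nonzero by auto

lemma norm_s: "norm s < 1"
proof -
  have "(norm s)\<^sup>2 < 1\<^sup>2" using norm_q s2 by (metis norm_power one_power2)
  then show ?thesis by (rule power2_less_imp_less) simp
qed

lemma s_powi_even: "s powi (2 * k) = q powi k"
  using power_int_mult[of s 2 k] s2 by simp

definition dilog_prod :: "gmono \<Rightarrow> complex" where
  "dilog_prod = lam_series (\<lambda>i. 0) (ratio_series N (dilog_coeff q))"

definition dilog_inv_prod :: "gmono \<Rightarrow> complex" where
  "dilog_inv_prod = lam_series (\<lambda>i. 0) (ratio_series N (dilog_inv_coeff q))"

lemma dilog_cone:
  "ratio_series N (dilog_coeff q) m \<noteq> 0 \<Longrightarrow> m \<in> ratio_cone N"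
  "ratio_series N (dilog_inv_coeff q) m \<noteq> 0 \<Longrightarrow> m \<in> ratio_cone N"
  by (rule ratio_series_cone, simp_all add: dilog_coeff_def dilog_inv_coeff_def)+

lemma dilog_prod_nonzeroD:
  assumes "dilog_prod (m, n, l) \<noteq> 0"
  shows "n = (\<lambda>i. 0) \<and> l = (\<lambda>i. 0) \<and> m \<in> ratio_cone N"
  using assms dilog_cone(1)[of m] unfolding dilog_prod_def lam_series_def prod.case
  by (cases "n = (\<lambda>i. 0) \<and> l = (\<lambda>i. 0)") simp_all

lemma dilog_inv_prod_nonzeroD:
  assumes "dilog_inv_prod (m, n, l) \<noteq> 0"
  shows "n = (\<lambda>i. 0) \<and> l = (\<lambda>i. 0) \<and> m \<in> ratio_cone N"
  using assms dilog_cone(2)[of m] unfolding dilog_inv_prod_def lam_series_def prod.case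
  by (cases "n = (\<lambda>i. 0) \<and> l = (\<lambda>i. 0)") simp_all

lemma dilog_prod_closed [simp]: "dilog_prod \<in> carrier R" "dilog_inv_prod \<in> carrier R"
  unfolding dilog_prod_def dilog_inv_prod_def
  by (rule lam_series_closed; use dilog_cone in auto)+

lemma dilog_prod_rec:
  assumes "a \<in> {1..<N}"
  shows "(1 - q powi (- psum m a)) * ratio_series N (dilog_coeff q) m
      = ratio_series N (dilog_coeff q) (\<lambda>i. m i - ratio_vec a i)"
  using ratio_series_rec[where A = "\<lambda>k. 1 - q powi k" and B = "\<lambda>k. 1", OF _ assms]
    dilog_coeff_rec[OF norm_q] by simp

lemma dilog_inv_prod_rec:
  assumes "a \<in> {1..<N}"
  shows "(1 - q powi (- psum m a)) * ratio_series N (dilog_inv_coeff q) m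
      = - (q powi (- psum m a - 1)) * ratio_series N (dilog_inv_coeff q) (\<lambda>i. m i - ratio_vec a i)"
  using ratio_series_rec[where A = "\<lambda>k. 1 - q powi k" and B = "\<lambda>k. - (q powi (k - 1))", OF _ assms]
    dilog_inv_coeff_rec[OF norm_q] by simp

text \<open>Conjugation by this monomial is the substitution of \<open>Lambda_i / q\<close> for
  \<open>Lambda_i\<close> with \<open>i\<close> at most \<open>a\<close>. It sends
  \<open>x_a\<close> to \<open>q x_a\<close> when \<open>a < N\<close> and fixes the other
  ratios.\<close>

definition T_inv_prod :: "nat \<Rightarrow> gmono \<Rightarrow> complex" where
  "T_inv_prod a = qmono (\<lambda>i. 0, \<lambda>i. - eps_upto a i, \<lambda>i. 0)"

lemma T_inv_prod_closed [simp]: "a \<le> N \<Longrightarrow> T_inv_prod a \<in> carrier R"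
  by (simp add: T_inv_prod_def)

lemma T_inv_prod_lam_series:
  assumes "a \<le> N"
  shows "T_inv_prod a \<otimes> lam_series (\<lambda>i. 0) f
      = lam_series (\<lambda>i. - eps_upto a i) (\<lambda>m. q powi (- psum m a) * f m)"
    and "lam_series (\<lambda>i. 0) f \<otimes> T_inv_prod a = lam_series (\<lambda>i. - eps_upto a i) f"
proof -
  have "(\<Sum>i\<in>{1..N}. 2 * (- eps_upto a i) * m i) = 2 * (- psum m a)" for m
    using sum_eps_upto[OF assms, of "\<lambda>i. - 2 * m i"] psum_mult[of "- 2" m a]
    by (simp add: mult_ac)
  then show "T_inv_prod a \<otimes> lam_series (\<lambda>i. 0) f
      = lam_series (\<lambda>i. - eps_upto a i) (\<lambda>m. q powi (- psum m a) * f m)"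
    unfolding T_inv_prod_def T_mult_lam_series by (simp only: s_powi_even) simp
  show "lam_series (\<lambda>i. 0) f \<otimes> T_inv_prod a = lam_series (\<lambda>i. - eps_upto a i) f"
    unfolding T_inv_prod_def lam_series_mult_T by simp
qed

definition one_minus_ratio :: "nat \<Rightarrow> gmono \<Rightarrow> complex" where
  "one_minus_ratio a = \<one> \<ominus> qmono (ratio_vec a, \<lambda>i. 0, \<lambda>i. 0)"

lemma one_minus_ratio_closed [simp]: "a \<in> {1..<N} \<Longrightarrow> one_minus_ratio a \<in> carrier R"
  by (simp add: one_minus_ratio_def)

text \<open>The operator form of \<open>phi(q x_a) = (1 - x_a) phi(x_a)\<close>; the other factors
  of the product are unaffected.\<close>

lemma T_inv_prod_dilog:
  assumes "a \<in> {1..<N}"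
  shows "T_inv_prod a \<otimes> dilog_prod = dilog_prod \<otimes> one_minus_ratio a \<otimes> T_inv_prod a"
proof -
  let ?f = "ratio_series N (dilog_coeff q)"
  have aN: "a \<le> N" using assms by simp
  have closed: "qmono (ratio_vec a, \<lambda>i. 0, \<lambda>i. 0) \<in> carrier R" using assms by simp
  have "dilog_prod \<otimes> one_minus_ratio a
      = dilog_prod \<ominus> dilog_prod \<otimes> qmono (ratio_vec a, \<lambda>i. 0, \<lambda>i. 0)"
    using closed by (simp add: one_minus_ratio_def a_minus_def r_distr r_minus)
  also have "\<dots> = lam_series (\<lambda>i. 0) (\<lambda>m. ?f m - ?f (\<lambda>i. m i - ratio_vec a i))"
    using closed unfolding minus_eq[OF dilog_prod_closed(1) m_closed[OF dilog_prod_closed(1) closed]]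
    by (simp add: dilog_prod_def lam_series_mult_Lam) (auto simp: lam_series_def)
  also have "\<dots> = lam_series (\<lambda>i. 0) (\<lambda>m. q powi (- psum m a) * ?f m)"
  proof (rule arg_cong[of _ _ "lam_series _"], rule ext)
    fix m
    show "?f m - ?f (\<lambda>i. m i - ratio_vec a i) = q powi (- psum m a) * ?f m"
      using dilog_prod_rec[OF assms, of m] by (simp add: algebra_simps)
  qed
  finally show ?thesis
    using T_inv_prod_lam_series[OF aN] by (simp add: dilog_prod_def)
qed

text \<open>The operator form of \<open>psi(x_a) = (1 - x_a) psi(q x_a)\<close>, arranged so that
  the factor \<open>1 - x_a\<close> matches the one in \<open>T_inv_prod_dilog\<close>.\<close>

lemma dilog_inv_T_inv_prod:
  assumes "a \<in> {1..<N}"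
  shows "dilog_inv_prod \<otimes> T_inv_prod a = one_minus_ratio a \<otimes> T_inv_prod a \<otimes> dilog_inv_prod"
proof -
  let ?h = "ratio_series N (dilog_inv_coeff q)"
  let ?x = "T_inv_prod a \<otimes> dilog_inv_prod"
  have aN: "a \<le> N" using assms by simp
  have closed: "qmono (ratio_vec a, \<lambda>i. 0, \<lambda>i. 0) \<in> carrier R" "?x \<in> carrier R"
    using assms by simp_all
  have x: "?x = lam_series (\<lambda>i. - eps_upto a i) (\<lambda>m. q powi (- psum m a) * ?h m)"
    unfolding dilog_inv_prod_def by (rule T_inv_prod_lam_series[OF aN])
  have "one_minus_ratio a \<otimes> T_inv_prod a \<otimes> dilog_inv_prod = one_minus_ratio a \<otimes> ?x"
    using assms by (simp add: m_assoc)
  also have "\<dots> = ?x \<ominus> qmono (ratio_vec a, \<lambda>i. 0, \<lambda>i. 0) \<otimes> ?x"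
    using closed by (simp add: one_minus_ratio_def a_minus_def l_distr l_minus)
  also have "\<dots> = lam_series (\<lambda>i. - eps_upto a i) (\<lambda>m. q powi (- psum m a) * ?h m
      - q powi (- psum m a - 1) * ?h (\<lambda>i. m i - ratio_vec a i))"
    unfolding minus_eq[OF closed(2) m_closed[OF closed]]
    using assms by (simp add: x Lam_mult_lam_series psum_ratio_vec) (auto simp: lam_series_def)
  also have "\<dots> = lam_series (\<lambda>i. - eps_upto a i) ?h"
  proof (rule arg_cong[of _ _ "lam_series _"], rule ext)
    fix m
    show "q powi (- psum m a) * ?h m - q powi (- psum m a - 1) * ?h (\<lambda>i. m i - ratio_vec a i) = ?h m"
      using dilog_inv_prod_rec[OF assms, of m] by (simp add: algebra_simps)
  qed
  finally show ?thesis
    using T_inv_prod_lam_series[OF aN] by (simp add: dilog_inv_prod_def)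
qed

text \<open>The product commutes with all \<open>(T\<^sub>1 \<cdots> T\<^sub>a)\<^sup>-\<^sup>1\<close>, hence is invariant under \<open>\<Lambda>\<^sub>i \<mapsto> q\<^sup>-\<^sup>1 \<Lambda>\<^sub>i\<close>
  for \<open>i \<le> a\<close>; only the constant term survives.\<close>
lemma dilog_prod_inverse: "dilog_prod \<otimes> dilog_inv_prod = \<one>"
proof -
  let ?F = "dilog_prod" and ?H = "dilog_inv_prod"
  define z where "z = (\<lambda>m. (?F \<otimes> ?H) (m, \<lambda>i. 0, \<lambda>i. 0))"
  have supp: "n = (\<lambda>i. 0) \<and> l = (\<lambda>i. 0) \<and> m \<in> ratio_cone N" if nz: "(?F \<otimes> ?H) (m, n, l) \<noteq> 0" for m n l
  proof -
    obtain p1 p2 where p: "?F p1 \<noteq> 0" "?H p2 \<noteq> 0" "mono_comp p1 p2 = (m, n, l)"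
      using mult_nonzeroD[OF nz] by (elim exE conjE)
    obtain m1 n1 l1 where p1: "p1 = (m1, n1, l1)" by (rule prod_cases3)
    obtain m2 n2 l2 where p2: "p2 = (m2, n2, l2)" by (rule prod_cases3)
    note p12 = p1 p2
    have 1: "n1 = (\<lambda>i. 0) \<and> l1 = (\<lambda>i. 0) \<and> m1 \<in> ratio_cone N"
      using p(1) unfolding p12 by (rule dilog_prod_nonzeroD)
    have 2: "n2 = (\<lambda>i. 0) \<and> l2 = (\<lambda>i. 0) \<and> m2 \<in> ratio_cone N"
      using p(2) unfolding p12 by (rule dilog_inv_prod_nonzeroD)
    have "(\<lambda>i. m1 i + m2 i) \<in> ratio_cone N" using 1 2 by (simp add: ratio_cone_add)
    moreover have "(m, n, l) = (\<lambda>i. m1 i + m2 i, \<lambda>i. 0, \<lambda>i. 0)"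
      unfolding p(3)[symmetric] p12 using 1 2 by simp
    ultimately show ?thesis by (simp only: prod.inject)
  qed
  have FH: "?F \<otimes> ?H = lam_series (\<lambda>i. 0) z"
  proof (rule ext, clarify)
    fix m n l
    show "(?F \<otimes> ?H) (m, n, l) = lam_series (\<lambda>i. 0) z (m, n, l)"
    proof (cases "n = (\<lambda>i. 0) \<and> l = (\<lambda>i. 0)")
      case False
      then have "(?F \<otimes> ?H) (m, n, l) = 0" using supp by blast
      then show ?thesis using False by (auto simp: lam_series_def)
    qed (simp add: lam_series_def z_def)
  qed
  have z0: "z m = 0" if "m \<noteq> (\<lambda>i. 0)" for m
  proof (rule ccontr)
    assume nz: "z m \<noteq> 0"
    then have m: "m \<in> ratio_cone N" using supp by (simp add: z_def)
    have "psum m a = 0" if a: "a \<in> {1..<N}" for a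
    proof -
      have aN: "a \<le> N" using a by simp
      have "T_inv_prod a \<otimes> (?F \<otimes> ?H) = T_inv_prod a \<otimes> ?F \<otimes> ?H"
        using aN by (simp add: m_assoc)
      \<comment> \<open>The first dilogarithm releases a factor \<open>1 - x_a\<close>, which the
        second one absorbs in the next step.\<close>
      also have "\<dots> = ?F \<otimes> (one_minus_ratio a \<otimes> T_inv_prod a \<otimes> ?H)"
        unfolding T_inv_prod_dilog[OF a] using a by (simp add: m_assoc)
      also have "\<dots> = ?F \<otimes> ?H \<otimes> T_inv_prod a"
        unfolding dilog_inv_T_inv_prod[OF a, symmetric] using aN by (simp add: m_assoc)
      finally have "lam_series (\<lambda>i. - eps_upto a i) (\<lambda>m. q powi (- psum m a) * z m)
          = lam_series (\<lambda>i. - eps_upto a i) z"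
        unfolding FH T_inv_prod_lam_series[OF aN] .
      from fun_cong[OF this, of "(m, \<lambda>i. - eps_upto a i, \<lambda>i. 0)"]
      have "q powi (- psum m a) = 1" using nz by (simp add: lam_series_def)
      then show ?thesis using power_int_eq_1_imp[OF norm_q q_nonzero] by force
    qed
    then have "m = (\<lambda>i. 0)"
      by (rule ratio_cone_eq_0[OF m])
    then show False using that by simp
  qed
  have "z (\<lambda>i. 0) = 1"
  proof -
    let ?o = "(\<lambda>i. 0, \<lambda>i. 0, \<lambda>i. 0) :: gmono"
    have F0: "?F ?o = 1" "?H ?o = 1"
      by (simp_all add: dilog_prod_def dilog_inv_prod_def lam_series_def ratio_series_0
          dilog_coeff_def dilog_inv_coeff_def binomial_eq_0)
    \<comment> \<open>The cone meets its negative only in 0: nonpositive partial sums adding up to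
      zero all vanish. So the constant term arises from a single pair.\<close>
    have "comp_pairs {p. ?F p \<noteq> 0} {p. ?H p \<noteq> 0} ?o = {(?o, ?o)}"
    proof
      show "{(?o, ?o)} \<subseteq> comp_pairs {p. ?F p \<noteq> 0} {p. ?H p \<noteq> 0} ?o"
        using F0 by (simp add: comp_pairs_def)
      show "comp_pairs {p. ?F p \<noteq> 0} {p. ?H p \<noteq> 0} ?o \<subseteq> {(?o, ?o)}"
      proof (rule subsetI, unfold split_paired_all)
        fix m1 n1 l1 m2 n2 l2
        assume "((m1, n1, l1), (m2, n2, l2)) \<in> comp_pairs {p. ?F p \<noteq> 0} {p. ?H p \<noteq> 0} ?o"
        then have nz: "?F (m1, n1, l1) \<noteq> 0" "?H (m2, n2, l2) \<noteq> 0"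
          and sum: "(\<lambda>i. m1 i + m2 i) = (\<lambda>i. 0)"
          by (simp_all add: comp_pairs_def)
        have cone: "m1 \<in> ratio_cone N" "m2 \<in> ratio_cone N"
          and nl: "n1 = (\<lambda>i. 0)" "l1 = (\<lambda>i. 0)" "n2 = (\<lambda>i. 0)" "l2 = (\<lambda>i. 0)"
          using dilog_prod_nonzeroD[OF nz(1)] dilog_inv_prod_nonzeroD[OF nz(2)] by simp_all
        have ps: "psum m1 a + psum m2 a = 0" for a
          using arg_cong[OF sum, of "\<lambda>m. psum m a"] by simp
        have "psum m1 a = 0 \<and> psum m2 a = 0" if "a \<in> {1..<N}" for a
        proof -
          have "psum m1 a \<le> 0" "psum m2 a \<le> 0"
            using that cone by (simp_all add: ratio_cone_iff)
          then show ?thesis using ps[of a] by linarith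
        qed
        then have "m1 = (\<lambda>i. 0)" "m2 = (\<lambda>i. 0)"
          using ratio_cone_eq_0[OF cone(1)] ratio_cone_eq_0[OF cone(2)] by blast+
        then show "((m1, n1, l1), (m2, n2, l2)) \<in> {(?o, ?o)}" using nl by simp
      qed
    qed
    moreover have "z (\<lambda>i. 0) = (\<Sum>(p1, p2)\<in>comp_pairs {p. ?F p \<noteq> 0} {p. ?H p \<noteq> 0} ?o.
        s powi mono_twist N p1 p2 * ?F p1 * ?H p2)"
      unfolding z_def using dilog_prod_closed
      by (intro mult_eq) (simp_all add: carrier_iff)
    ultimately show ?thesis using F0 by simp
  qed
  then have "z m = (if m = (\<lambda>i. 0) then 1 else 0)" for m
    using z0[of m] by simp
  then have "lam_series (\<lambda>i. 0) z = \<one>"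
    by (simp add: lam_series_def one_eq qmono_def fun_eq_iff)
  then show ?thesis unfolding FH .
qed

lemma dilog_prod_Units: "dilog_prod \<in> Units R"
proof -
  have "dilog_inv_prod \<otimes> dilog_prod = \<one>"
    using dilog_prod_inverse dilog_prod_closed
    unfolding dilog_prod_def dilog_inv_prod_def by (subst lam_series_mult_commute)
  then show ?thesis
    using dilog_prod_inverse unfolding Units_def by (auto intro!: bexI[of _ dilog_inv_prod])
qed

section \<open>The generator: existence and uniqueness up to a scalar\<close>

definition Q_generator :: "gmono \<Rightarrow> complex" where
  "Q_generator = gauss_series (ratio_series N (dilog_coeff q))"

text \<open>It is the product of the invertible monomial \<open>G_1 ... G_N\<close> and the unit
  \<open>dilog_prod\<close>.\<close>

lemma Q_generator_Units: "Q_generator \<in> Units R"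
proof -
  let ?u = "eps_upto N"
  let ?f = "ratio_series N (dilog_coeff q)"
  have "Q_generator = qmono (\<lambda>i. 0, \<lambda>i. 0, ?u) \<otimes> dilog_prod"
  proof (rule ext, clarify)
    fix m n l
    have l: "(\<lambda>i. l i - ?u i) = (\<lambda>i. 0) \<longleftrightarrow> l = ?u"
      by (auto simp: fun_eq_iff)
    show "Q_generator (m, n, l) = (qmono (\<lambda>i. 0, \<lambda>i. 0, ?u) \<otimes> dilog_prod) (m, n, l)"
    proof (cases "m \<in> zvecs N")
      case True
      then have um: "?u i * m i = m i" for i by (auto simp: zvecs_def eps_upto_def)
      have "(\<Sum>i\<in>{1..N}. ?u i * (m i)\<^sup>2) = sqnorm N m"
        unfolding sqnorm_def by (rule sum.cong) (simp_all add: eps_upto_def)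
      moreover have "(\<lambda>i. n i - m i) = (\<lambda>i. 0) \<longleftrightarrow> n = m"
        by (auto simp: fun_eq_iff)
      ultimately show ?thesis
        by (simp add: Q_generator_def gauss_series_def dilog_prod_def qmono_mult_left lam_series_def um l)
    next
      case False
      then have "?f m = 0" by (simp add: ratio_series_def)
      then show ?thesis
        by (simp add: Q_generator_def gauss_series_def dilog_prod_def qmono_mult_left lam_series_def)
    qed
  qed
  moreover have "qmono (\<lambda>i. 0, \<lambda>i. 0, ?u) \<in> Units R"
  proof -
    have "qmono (\<lambda>i. 0, \<lambda>i. 0, ?u) \<otimes> qmono (\<lambda>i. 0, \<lambda>i. 0, \<lambda>i. - ?u i) = \<one>"
      "qmono (\<lambda>i. 0, \<lambda>i. 0, \<lambda>i. - ?u i) \<otimes> qmono (\<lambda>i. 0, \<lambda>i. 0, ?u) = \<one>"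
      by (simp_all add: qmono_mult_qmono one_eq)
    moreover have "qmono (\<lambda>i. 0, \<lambda>i. 0, \<lambda>i. - ?u i) \<in> carrier R" "qmono (\<lambda>i. 0, \<lambda>i. 0, ?u) \<in> carrier R"
      by simp_all
    ultimately show ?thesis unfolding Units_def by blast
  qed
  ultimately show ?thesis using dilog_prod_Units by simp
qed

lemma Q_generator_generates: "generates_Q_solution N q s Q_generator"
proof (rule linear_imp_generates[OF Q_generator_Units])
  fix a assume a: "a \<in> {1..N}"
  then show "Q_generator \<otimes> Lam_prod a = (s ^ a) \<odot> (LamT_prod a \<otimes> Q_generator)"
    unfolding Q_generator_def by (intro gauss_series_Lam_prod) simp
  \<comment> \<open>For \<open>a = N\<close> the left-hand side vanishes because
    \<open>ratio_series\<close> is supported on vectors with \<open>psum m N = 0\<close>.\<close>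
  have "(1 - s powi (- 2 * psum m a)) * ratio_series N (dilog_coeff q) m
      = (if a = N then 0 else ratio_series N (dilog_coeff q) (\<lambda>i. m i - ratio_vec a i))" for m
    using dilog_prod_rec[of a m] a s_powi_even[of "- psum m a"] by (auto simp: ratio_series_def)
  then show "(s ^ (3 * a)) \<odot> (Lam_prod a \<otimes> Q_generator \<otimes> LamT_prod a) = Q_generator \<otimes> Q_rhs a"
    unfolding Q_generator_def using a Units_closed[OF Q_generator_Units]
    by (subst gauss_series_Q_relation_iff) (auto simp: Q_generator_def)
qed

text \<open>The linear equations make \<open>g\<close> a Gauss series whose coefficients
  \<open>f\<close> obey the dilogarithm recursion. The support condition confines \<open>f\<close>
  to the ratio cone, where the recursion determines it from its value at 0.\<close>

lemma generates_imp_multiple: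
  assumes N: "N \<ge> 1" and gen: "generates_Q_solution N q s g"
  shows "\<exists>c. c \<noteq> 0 \<and> g = c \<odot> Q_generator"
proof -
  have g: "g \<in> Units R" using gen by (simp add: generates_Q_solution_def R_def)
  then have gc: "g \<in> carrier R" by (rule Units_closed)
  note lin = generates_imp_linear[OF gen]
  obtain f where gf: "g = gauss_series f"
    using linear_imp_gauss_series[OF gc norm_s lin(1)] by blast
  have rec: "(1 - q powi (- psum m a)) * f m = (if a = N then 0 else f (\<lambda>i. m i - ratio_vec a i))"
    if a: "a \<in> {1..N}" for m a
  proof -
    have "\<forall>m. (1 - s powi (- 2 * psum m a)) * f m = (if a = N then 0 else f (\<lambda>i. m i - ratio_vec a i))"
      using lin(2)[OF a] gc a unfolding gf by (subst (asm) gauss_series_Q_relation_iff) simp_all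
    from this[rule_format, of m] show ?thesis using s_powi_even[of "- psum m a"] by simp
  qed
  have q1: "1 - q powi k \<noteq> 0" if "k \<noteq> 0" for k
    using power_int_eq_1_imp[OF norm_q q_nonzero, of k] that by auto
  have nzg: "g (m, m, eps_upto N) \<noteq> 0" if "f m \<noteq> 0" for m
    using that s_nonzero by (simp add: gf gauss_series_def)
  have cone: "m \<in> ratio_cone N" if nz: "f m \<noteq> 0" for m
    unfolding ratio_cone_iff
  proof (intro conjI ballI)
    show "m \<in> zvecs N"
      using gc nzg[OF nz] unfolding carrier_iff admissible_def mem_Collect_eq by blast
    have "(1 - q powi (- psum m N)) * f m = 0" using rec[of N m] N by simp
    then have "1 - q powi (- psum m N) = 0" using nz by simp
    then show "psum m N = 0" using q1[of "- psum m N"] by linarith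
    fix a assume a: "a \<in> {1..<N}"
    show "psum m a \<le> 0"
    proof (rule ccontr)
      assume pos: "\<not> psum m a \<le> 0"
      have ps: "psum (\<lambda>i. m i - int t * ratio_vec a i) a = psum m a + int t" for t
        using a by (simp add: psum_mult psum_ratio_vec)
      \<comment> \<open>A positive partial sum only grows along this direction, so the recursion
        factor never vanishes and nonvanishing propagates without end.\<close>
      have nzt: "f (\<lambda>i. m i - int t * ratio_vec a i) \<noteq> 0" for t
      proof (induction t)
        case (Suc t)
        let ?m = "\<lambda>i. m i - int t * ratio_vec a i"
        have step: "(\<lambda>i. ?m i - ratio_vec a i) = (\<lambda>i. m i - int (Suc t) * ratio_vec a i)"
          by (rule ext) (simp add: algebra_simps)
        have "- psum ?m a \<noteq> 0" using pos ps[of t] by linarith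
        then have "(1 - q powi (- psum ?m a)) * f ?m \<noteq> 0"
          using q1 Suc.IH by (intro no_zero_divisors)
        moreover have "(1 - q powi (- psum ?m a)) * f ?m = f (\<lambda>i. ?m i - ratio_vec a i)"
          using rec[of a ?m] a by simp
        ultimately show ?case unfolding step by argo
      qed (use nz in simp)
      obtain F where F: "finite F"
        "\<forall>m n l. (m, n, l) \<in> {p. g p \<noteq> 0} \<longrightarrow> (\<exists>m0\<in>F. (\<lambda>i. m i - m0 i) \<in> ratio_cone N)"
        using gc unfolding carrier_iff admissible_def by (elim conjE exE)
      \<comment> \<open>This bounds the \<open>a\<close>-th partial sums of all base points, so
        after \<open>t\<close> steps the exponent lies outside every translate of the cone.\<close>
      define t where "t = nat (Max ((\<lambda>m0. psum m0 a) ` F))"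
      let ?m = "\<lambda>i. m i - int t * ratio_vec a i"
      have "(?m, ?m, eps_upto N) \<in> {p. g p \<noteq> 0}" by (rule CollectI) (rule nzg[OF nzt])
      from F(2)[rule_format, OF this]
      obtain m0 where m0: "m0 \<in> F" "(\<lambda>i. ?m i - m0 i) \<in> ratio_cone N"
        by (elim bexE)
      have "psum m0 a \<le> Max ((\<lambda>m0. psum m0 a) ` F)"
        using F(1) m0(1) by (intro Max_ge finite_imageI imageI)
      then have "psum m0 a \<le> int t" unfolding t_def by linarith
      moreover have "psum (\<lambda>i. ?m i - m0 i) a \<le> 0"
        using m0(2) a unfolding ratio_cone_iff by (elim conjE bspec)
      then have "psum m a + int t - psum m0 a \<le> 0"
        using ps[of t] by (simp only: psum_diff)
      ultimately show False using pos by linarith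
    qed
  qed
  define f0 where "f0 = ratio_series N (dilog_coeff q)"
  have f0_0: "f0 (\<lambda>i. 0) = 1"
    by (simp add: f0_def ratio_series_0 dilog_coeff_def)
  have "f m = f (\<lambda>i. 0) * f0 m" for m
  proof (cases "m \<in> ratio_cone N")
    case True
    then show ?thesis
    \<comment> \<open>The measure is the total degree in the ratios; one step of the recursion
      lowers it by one.\<close>
    proof (induction "nat (- (\<Sum>a\<in>{1..<N}. psum m a))" arbitrary: m rule: less_induct)
      case less
      show ?case
      proof (cases "\<exists>a\<in>{1..<N}. psum m a \<noteq> 0")
        case True
        then obtain a where a: "a \<in> {1..<N}" "psum m a < 0"
          using less.prems unfolding ratio_cone_iff by force
        let ?m = "\<lambda>i. m i - ratio_vec a i"
        have ps: "psum ?m b = psum m b + (if b = a then 1 else 0)" for b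
          using a by (simp add: psum_ratio_vec)
        have cone': "?m \<in> ratio_cone N"
          using less.prems a by (auto simp: ratio_cone_iff ps simp del: psum_diff)
        have "(\<Sum>b\<in>{1..<N}. psum ?m b) = (\<Sum>b\<in>{1..<N}. psum m b) + 1"
          unfolding ps sum.distrib using a by (simp add: sum.delta)
        moreover have "(\<Sum>b\<in>{1..<N}. psum ?m b) \<le> 0"
          using cone' by (intro sum_nonpos) (auto simp: ratio_cone_iff)
        ultimately have "f ?m = f (\<lambda>i. 0) * f0 ?m"
          by (intro less.hyps cone') linarith
        moreover have "(1 - q powi (- psum m a)) * f m = f ?m"
          using rec[of a m] a by auto
        moreover have "(1 - q powi (- psum m a)) * f0 m = f0 ?m"
          unfolding f0_def using a by (intro dilog_prod_rec)
        ultimately have "(1 - q powi (- psum m a)) * f m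
            = (1 - q powi (- psum m a)) * (f (\<lambda>i. 0) * f0 m)"
          by (metis mult.left_commute)
        then show ?thesis using q1[of "- psum m a"] a by simp
      next
        case False
        then have "m = (\<lambda>i. 0)"
          using ratio_cone_eq_0[OF less.prems] by blast
        then show ?thesis by (simp add: f0_0)
      qed
    qed
  next
    case False
    then have "f m = 0" "f0 m = 0" using cone dilog_cone unfolding f0_def by blast+
    then show ?thesis by simp
  qed
  then have "f = (\<lambda>m. f (\<lambda>i. 0) * f0 m)" by (rule ext)
  then have g_eq: "g = f (\<lambda>i. 0) \<odot> Q_generator"
    unfolding gf Q_generator_def gauss_series_smult f0_def by (rule arg_cong)
  \<comment> \<open>A zero constant would make the unit \<open>g\<close> zero, hence 1 = 0 in the
    ring.\<close>
  moreover have "f (\<lambda>i. 0) \<noteq> 0"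
  proof
    assume "f (\<lambda>i. 0) = 0"
    then have "g = \<zero>" using g_eq by (simp add: smult_eq zero_eq)
    then have "\<one> = \<zero>" using Units_r_inv[OF g] Units_inv_closed[OF g] by simp
    from fun_cong[OF this, of "(\<lambda>i. 0, \<lambda>i. 0, \<lambda>i. 0)"] show False
      by (simp add: one_eq zero_eq qmono_def)
  qed
  ultimately show ?thesis by blast
qed

text \<open>The two families of equations are linear and homogeneous in \<open>g\<close>, and a
  nonzero multiple of a unit is a unit.\<close>

lemma multiple_generates:
  assumes c: "c \<noteq> 0"
  shows "generates_Q_solution N q s (c \<odot> Q_generator)"
proof (rule linear_imp_generates)
  note lin = generates_imp_linear[OF Q_generator_generates]
  have G: "Q_generator \<in> carrier R" "inv Q_generator \<in> carrier R"
    using Q_generator_Units by (auto intro: Units_closed)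
  then have "(c \<odot> Q_generator) \<otimes> ((1 / c) \<odot> inv Q_generator) = \<one>"
    "((1 / c) \<odot> inv Q_generator) \<otimes> (c \<odot> Q_generator) = \<one>"
    using c Q_generator_Units by simp_all
  then show "c \<odot> Q_generator \<in> Units R"
    using G smult_closed unfolding Units_def by blast
  fix a assume a: "a \<in> {1..N}"
  have "c \<odot> (Q_generator \<otimes> Lam_prod a) = c \<odot> ((s ^ a) \<odot> (LamT_prod a \<otimes> Q_generator))"
    by (simp only: lin(1)[OF a])
  then show "(c \<odot> Q_generator) \<otimes> Lam_prod a = (s ^ a) \<odot> (LamT_prod a \<otimes> (c \<odot> Q_generator))"
    by (simp add: mult.commute)
  have "c \<odot> ((s ^ (3 * a)) \<odot> (Lam_prod a \<otimes> Q_generator \<otimes> LamT_prod a)) = c \<odot> (Q_generator \<otimes> Q_rhs a)"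
    by (simp only: lin(2)[OF a])
  then show "(s ^ (3 * a)) \<odot> (Lam_prod a \<otimes> (c \<odot> Q_generator) \<otimes> LamT_prod a) = (c \<odot> Q_generator) \<otimes> Q_rhs a"
    by (simp add: mult.commute)
qed

end

theorem theorem2p7:
  fixes N :: nat and q s :: complex
  assumes "N \<ge> 1" and "q \<noteq> 0" and "norm q < 1" and "s\<^sup>2 = q"
  shows "\<exists>g. generates_Q_solution N q s g \<and>
           (\<forall>g'. generates_Q_solution N q s g' \<longleftrightarrow>
              (\<exists>c. c \<noteq> 0 \<and> g' = c \<odot>\<^bsub>qtorus N s\<^esub> g))"
proof -
  interpret qtorus_small N s "qtorus N s" q
    by unfold_locales (use assms in auto)
  show ?thesis
    using Q_generator_generates generates_imp_multiple[OF assms(1)] multiple_generates by blast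
qed

end
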